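(* Let $V$ be a closed isometric operator in a Hilbert space $H$. An arbitrary generalized resolvent $\mathbf{R}_\zeta$ of $V$ has the form $$\mathbf{R}_\zeta=\left[E_H-\zeta\,(V\oplus F_\zeta)\right]^{-1},\qquad \zeta\in\mathbb{D},\qquad ( * )$$ where $F_\zeta$ is a function from $\mathcal{S}(\mathbb{D};N_0(V),N_\infty(V))$. Conversely, an arbitrary function $F_\zeta\in\mathcal{S}(\mathbb{D};N_0(V),N_\infty(V))$ defines by relation $( * )$ a generalized resolvent $\mathbf{R}_\zeta$ of $V$. Moreover, to different functions from $\mathcal{S}(\mathbb{D};N_0(V),N_\infty(V))$ there correspond different generalized resolvents of $V$.
   Context: Hilbert spaces are complex and separable; operators are linear. $\mathbb{D}=\{|z|<1\}$, $\mathbb{T}=\{|z|=1\}$, $\mathbb{T}_e=\{z\in\mathbb{C}:|z|\neq1\}$. $E_H$ is the identity operator in $H$; $P^{\widetilde H}_H$ is the orthogonal projection of $\widetilde H$ onto its subspace $H$. $V$ is a closed isometric operator in $H$ with domain $D(V)$ (hence a closed subspace, not necessarily all of $H$) and range $R(V)$. $N_0(V)=H\ominus D(V)$, $N_\infty(V)=H\ominus R(V)$. Generalized resolvent: let $U\supseteq V$ be a unitary operator in a Hilbert space $\widetilde H\supseteq H$ (such extensions always exist). The operator-valued function $\mathbf{R}_\zeta=P^{\widetilde H}_H(E_{\widetilde H}-\zeta U)^{-1}|_H$, $\zeta\in\mathbb{T}_e$, is called a generalized resolvent of $V$ (corresponding to $U$). It satisfies $\mathbf{R}_\zeta^*=E_H-\mathbf{R}_{1/\overline{\zeta}}$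 for $\zeta\in\mathbb{T}_e\setminus\{0\}$, so it is determined by its values in $\mathbb{D}$. $\mathcal{S}(D;N,N')$ is the class of all operator-valued functions analytic in the domain $D\subseteq\mathbb{C}$ whose values are linear non-expanding operators (norm $\le1$) mapping the whole Hilbert space $N$ into the Hilbert space $N'$. $V\oplus F_\zeta$ is the operator on $H=D(V)\oplus N_0(V)$ equal to $V$ on $D(V)$ and to $F_\zeta$ on $N_0(V)$. *)

theory Defs
  imports "HOL-Analysis.Analysis"
begin

section \<open>Complex separable Hilbert spaces\<close>

class scaleC =
  fixes scaleC :: "complex \<Rightarrow> 'a \<Rightarrow> 'a"  (infixr \<open>*\<^sub>C\<close> 75)

(* The inner product is linear in its first argument.  The axiom cinner_same ties it to the
   norm of the library, so that positive definiteness is inherited from the norm axioms. *)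
class complex_hilbert_space = banach + scaleC +
  fixes cinner :: "'a \<Rightarrow> 'a \<Rightarrow> complex"
  assumes scaleR_scaleC: "r *\<^sub>R x = complex_of_real r *\<^sub>C x"
    and scaleC_add_right: "a *\<^sub>C (x + y) = a *\<^sub>C x + a *\<^sub>C y"
    and scaleC_add_left: "(a + b) *\<^sub>C x = a *\<^sub>C x + b *\<^sub>C x"
    and scaleC_scaleC: "a *\<^sub>C b *\<^sub>C x = (a * b) *\<^sub>C x"
    and cinner_commute: "cinner x y = cnj (cinner y x)"
    and cinner_add_left: "cinner (x + y) z = cinner x z + cinner y z"
    and cinner_scaleC_left: "cinner (a *\<^sub>C x) y = a * cinner x y"
    and cinner_same: "cinner x x = complex_of_real ((norm x)\<^sup>2)"

class separable_complex_hilbert_space = complex_hilbert_space +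
  assumes separable: "\<exists>A. countable A \<and> (\<forall>x. \<forall>e>0. \<exists>y\<in>A. dist y x < e)"

lemma scaleC_one: "1 *\<^sub>C x = (x :: 'a::complex_hilbert_space)"
  using scaleR_scaleC[of 1 x] by simp

global_interpretation complex_vector:
  vector_space "scaleC :: complex \<Rightarrow> 'a \<Rightarrow> 'a::complex_hilbert_space"
  by unfold_locales (simp_all add: scaleC_add_right scaleC_add_left scaleC_scaleC scaleC_one)

definition orthogonal_complement :: "'a::complex_hilbert_space set \<Rightarrow> 'a set" where
  "orthogonal_complement S = {x. \<forall>y\<in>S. cinner x y = 0}"

(* Meaningful for closed subspaces S. *)
definition orthogonal_projection :: "'a::complex_hilbert_space set \<Rightarrow> 'a \<Rightarrow> 'a" where
  "orthogonal_projection S x = (THE y. y \<in> S \<and> x - y \<in> orthogonal_complement S)"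


section \<open>The sequence space of square-summable complex sequences\<close>

(* Every infinite-dimensional separable Hilbert space is isometrically isomorphic to ell2. *)
typedef ell2 = "{x :: nat \<Rightarrow> complex. summable (\<lambda>n. (cmod (x n))\<^sup>2)}"
  morphisms ell2_nth Abs_ell2
  by (rule exI[of _ "\<lambda>_. 0"]) simp

setup_lifting type_definition_ell2

lemma square_summable_add:
  fixes x y :: "nat \<Rightarrow> complex"
  assumes "summable (\<lambda>n. (cmod (x n))\<^sup>2)" "summable (\<lambda>n. (cmod (y n))\<^sup>2)"
  shows "summable (\<lambda>n. (cmod (x n + y n))\<^sup>2)"
proof (rule summable_comparison_test')
  show "summable (\<lambda>n. 2 * (cmod (x n))\<^sup>2 + 2 * (cmod (y n))\<^sup>2)"
    using assms by (intro summable_add summable_mult)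
  show "norm ((cmod (x n + y n))\<^sup>2) \<le> 2 * (cmod (x n))\<^sup>2 + 2 * (cmod (y n))\<^sup>2" for n
  proof -
    have "(cmod (x n + y n))\<^sup>2 \<le> (cmod (x n) + cmod (y n))\<^sup>2"
      by (intro power_mono norm_triangle_ineq) auto
    also have "\<dots> \<le> 2 * (cmod (x n))\<^sup>2 + 2 * (cmod (y n))\<^sup>2"
      using sum_squares_bound[of "cmod (x n)" "cmod (y n)"] by (simp add: power2_sum)
    finally show ?thesis by simp
  qed
qed

lemma square_summable_scale:
  fixes x :: "nat \<Rightarrow> complex"
  assumes "summable (\<lambda>n. (cmod (x n))\<^sup>2)"
  shows "summable (\<lambda>n. (cmod (a * x n))\<^sup>2)"
  using summable_mult[OF assms, of "(cmod a)\<^sup>2"] by (simp add: norm_mult power_mult_distrib)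

lemma square_summable_mult:
  fixes x y :: "nat \<Rightarrow> complex"
  assumes "summable (\<lambda>n. (cmod (x n))\<^sup>2)" "summable (\<lambda>n. (cmod (y n))\<^sup>2)"
  shows "summable (\<lambda>n. x n * cnj (y n))"
proof (rule summable_comparison_test')
  show "summable (\<lambda>n. (cmod (x n))\<^sup>2 + (cmod (y n))\<^sup>2)"
    using assms by (rule summable_add)
  show "norm (x n * cnj (y n)) \<le> (cmod (x n))\<^sup>2 + (cmod (y n))\<^sup>2" for n
  proof -
    have "norm (x n * cnj (y n)) = cmod (x n) * cmod (y n)" by (simp add: norm_mult)
    moreover have "2 * cmod (x n) * cmod (y n) \<le> (cmod (x n))\<^sup>2 + (cmod (y n))\<^sup>2"
      by (rule sum_squares_bound)
    moreover have "0 \<le> cmod (x n) * cmod (y n)" by simp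
    ultimately show ?thesis by linarith
  qed
qed

instantiation ell2 :: real_normed_vector
begin

lift_definition zero_ell2 :: ell2 is "\<lambda>_. 0" by simp
lift_definition plus_ell2 :: "ell2 \<Rightarrow> ell2 \<Rightarrow> ell2" is "\<lambda>x y n. x n + y n"
  by (rule square_summable_add)
lift_definition uminus_ell2 :: "ell2 \<Rightarrow> ell2" is "\<lambda>x n. - x n" by simp
lift_definition minus_ell2 :: "ell2 \<Rightarrow> ell2 \<Rightarrow> ell2" is "\<lambda>x y n. x n - y n"
  subgoal for x y using square_summable_add[of x "\<lambda>n. - y n"] by simp
  done
lift_definition scaleR_ell2 :: "real \<Rightarrow> ell2 \<Rightarrow> ell2" is "\<lambda>r x n. complex_of_real r * x n"
  by (rule square_summable_scale)
lift_definition norm_ell2 :: "ell2 \<Rightarrow> real" is "\<lambda>x. sqrt (\<Sum>n. (cmod (x n))\<^sup>2)" .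

definition "sgn (x :: ell2) = inverse (norm x) *\<^sub>R x"
definition "dist (x :: ell2) y = norm (x - y)"
definition "(uniformity :: (ell2 \<times> ell2) filter) = (INF e\<in>{0<..}. principal {(x, y). dist x y < e})"
definition "open (U :: ell2 set) \<longleftrightarrow> (\<forall>x\<in>U. \<forall>\<^sub>F (x', y) in uniformity. x' = x \<longrightarrow> y \<in> U)"

instance
proof
  fix x y z :: ell2 and a b :: real
  show "x + y + z = x + (y + z)" by transfer (simp add: add.assoc)
  show "x + y = y + x" by transfer (simp add: add.commute)
  show "0 + x = x" by transfer simp
  show "- x + x = 0" by transfer simp
  show "x - y = x + - y" by transfer simp
  show "a *\<^sub>R (x + y) = a *\<^sub>R x + a *\<^sub>R y" by transfer (simp add: ring_distribs)
  show "(a + b) *\<^sub>R x = a *\<^sub>R x + b *\<^sub>R x" by transfer (simp add: ring_distribs)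
  show "a *\<^sub>R b *\<^sub>R x = (a * b) *\<^sub>R x" by transfer (simp add: mult.assoc)
  show "1 *\<^sub>R x = x" by transfer simp
  show "norm x = 0 \<longleftrightarrow> x = 0"
    by transfer (simp add: suminf_eq_zero_iff fun_eq_iff)
  show "norm (a *\<^sub>R x) = \<bar>a\<bar> * norm x"
    by transfer (simp add: norm_mult power_mult_distrib suminf_mult real_sqrt_mult)
  show "norm (x + y) \<le> norm x + norm y"
  proof transfer
    fix x y :: "nat \<Rightarrow> complex"
    assume x: "summable (\<lambda>n. (cmod (x n))\<^sup>2)" and y: "summable (\<lambda>n. (cmod (y n))\<^sup>2)"
    let ?b = "sqrt (\<Sum>n. (cmod (x n))\<^sup>2) + sqrt (\<Sum>n. (cmod (y n))\<^sup>2)"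
    have fin: "L2_set (\<lambda>n. cmod (z n)) {..<k} \<le> sqrt (\<Sum>n. (cmod (z n))\<^sup>2)"
      if "summable (\<lambda>n. (cmod (z n))\<^sup>2)" for z :: "nat \<Rightarrow> complex" and k
      unfolding L2_set_def using that by (intro real_sqrt_le_mono sum_le_suminf) auto
    have "(\<Sum>n<k. (cmod (x n + y n))\<^sup>2) \<le> ?b\<^sup>2" for k
    proof -
      have "L2_set (\<lambda>n. cmod (x n + y n)) {..<k} \<le> L2_set (\<lambda>n. cmod (x n) + cmod (y n)) {..<k}"
        by (intro L2_set_mono norm_triangle_ineq) auto
      also have "\<dots> \<le> L2_set (\<lambda>n. cmod (x n)) {..<k} + L2_set (\<lambda>n. cmod (y n)) {..<k}"
        by (rule L2_set_triangle_ineq)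
      also have "\<dots> \<le> ?b" using fin[OF x] fin[OF y] by (intro add_mono)
      finally have "(L2_set (\<lambda>n. cmod (x n + y n)) {..<k})\<^sup>2 \<le> ?b\<^sup>2"
        by (intro power_mono) auto
      then show ?thesis unfolding L2_set_def by (simp add: sum_nonneg)
    qed
    then have "(\<Sum>n. (cmod (x n + y n))\<^sup>2) \<le> ?b\<^sup>2"
      by (intro suminf_le_const square_summable_add x y) auto
    moreover have "0 \<le> ?b" using x y by (intro add_nonneg_nonneg real_sqrt_ge_zero suminf_nonneg) auto
    ultimately show "sqrt (\<Sum>n. (cmod (x n + y n))\<^sup>2) \<le> ?b" by (intro real_le_lsqrt) auto
  qed
qed (simp_all add: sgn_ell2_def dist_ell2_def uniformity_ell2_def open_ell2_def)

end

lemma ell2_summable: "summable (\<lambda>n. (cmod (ell2_nth x n))\<^sup>2)"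
  using ell2_nth[of x] by simp

lemma norm_ell2_power2: "(norm x)\<^sup>2 = (\<Sum>n. (cmod (ell2_nth x n))\<^sup>2)"
  unfolding norm_ell2.rep_eq by (simp add: suminf_nonneg ell2_summable)

lemma ell2_sum_le_norm: "(\<Sum>n<k. (cmod (ell2_nth x n))\<^sup>2) \<le> (norm x)\<^sup>2"
  unfolding norm_ell2_power2 by (intro sum_le_suminf ell2_summable) auto

lemma ell2_nth_le_norm: "cmod (ell2_nth x n) \<le> norm x"
proof -
  have "(cmod (ell2_nth x n))\<^sup>2 \<le> (\<Sum>i<Suc n. (cmod (ell2_nth x i))\<^sup>2)"
    by (simp add: sum_nonneg)
  also have "\<dots> \<le> (norm x)\<^sup>2" by (rule ell2_sum_le_norm)
  finally show ?thesis by (rule power2_le_imp_le) simp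
qed

lemma ell2_norm_le:
  assumes "\<And>k. (\<Sum>n<k. (cmod (ell2_nth x n))\<^sup>2) \<le> e\<^sup>2" "0 \<le> e"
  shows "norm x \<le> e"
proof (rule power2_le_imp_le)
  show "(norm x)\<^sup>2 \<le> e\<^sup>2"
    unfolding norm_ell2_power2 using assms by (intro suminf_le_const ell2_summable) auto
qed (rule assms)

instance ell2 :: complete_space
proof
  fix X :: "nat \<Rightarrow> ell2"
  assume X: "Cauchy X"
  have "Cauchy (\<lambda>k. ell2_nth (X k) n)" for n
  proof (rule CauchyI)
    fix e :: real assume "0 < e"
    then obtain M where M: "\<And>m k. m \<ge> M \<Longrightarrow> k \<ge> M \<Longrightarrow> norm (X m - X k) < e"
      using CauchyD[OF X] by blast
    have "norm (ell2_nth (X m) n - ell2_nth (X k) n) \<le> norm (X m - X k)" for m k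
      using ell2_nth_le_norm[of "X m - X k" n] by (simp add: minus_ell2.rep_eq)
    with M show "\<exists>M. \<forall>m\<ge>M. \<forall>k\<ge>M. norm (ell2_nth (X m) n - ell2_nth (X k) n) < e"
      by (meson order_le_less_trans)
  qed
  then obtain L where L: "\<And>n. (\<lambda>k. ell2_nth (X k) n) \<longlonglongrightarrow> L n"
    unfolding Cauchy_convergent_iff convergent_def by metis
  have key: "\<exists>M. \<forall>m\<ge>M. \<forall>j. (\<Sum>n<j. (cmod (ell2_nth (X m) n - L n))\<^sup>2) \<le> e\<^sup>2" if e: "0 < e" for e
  proof -
    obtain M where M: "\<And>m k. m \<ge> M \<Longrightarrow> k \<ge> M \<Longrightarrow> norm (X m - X k) < e"
      using CauchyD[OF X e] by blast
    have "(\<Sum>n<j. (cmod (ell2_nth (X m) n - L n))\<^sup>2) \<le> e\<^sup>2" if m: "m \<ge> M" for m j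
    proof (rule LIMSEQ_le_const2)
      show "(\<lambda>k. \<Sum>n<j. (cmod (ell2_nth (X m) n - ell2_nth (X k) n))\<^sup>2)
              \<longlonglongrightarrow> (\<Sum>n<j. (cmod (ell2_nth (X m) n - L n))\<^sup>2)"
        by (intro tendsto_intros L)
      have "(\<Sum>n<j. (cmod (ell2_nth (X m) n - ell2_nth (X k) n))\<^sup>2) \<le> e\<^sup>2" if "k \<ge> M" for k
      proof -
        have "(\<Sum>n<j. (cmod (ell2_nth (X m) n - ell2_nth (X k) n))\<^sup>2) \<le> (norm (X m - X k))\<^sup>2"
          using ell2_sum_le_norm[of "X m - X k" j] by (simp add: minus_ell2.rep_eq)
        also have "\<dots> \<le> e\<^sup>2" using M[OF m that] by (intro power_mono) auto
        finally show ?thesis .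
      qed
      then show "\<exists>N. \<forall>k\<ge>N. (\<Sum>n<j. (cmod (ell2_nth (X m) n - ell2_nth (X k) n))\<^sup>2) \<le> e\<^sup>2" by blast
    qed
    then show ?thesis by blast
  qed
  obtain M where M: "\<And>j. (\<Sum>n<j. (cmod (ell2_nth (X M) n - L n))\<^sup>2) \<le> 1\<^sup>2"
    using key[of 1] by auto
  have "summable (\<lambda>n. (cmod (ell2_nth (X M) n - L n))\<^sup>2)"
    using M by (intro summableI_nonneg_bounded[of _ "1\<^sup>2"]) auto
  then have "summable (\<lambda>n. (cmod (- (ell2_nth (X M) n - L n)))\<^sup>2)" by (simp only: norm_minus_cancel)
  from square_summable_add[OF ell2_summable[of "X M"] this]
  have "summable (\<lambda>n. (cmod (L n))\<^sup>2)" by simp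
  then have nth: "ell2_nth (Abs_ell2 L) = L" by (simp add: Abs_ell2_inverse)
  have "X \<longlonglongrightarrow> Abs_ell2 L"
  proof (rule LIMSEQ_I)
    fix r :: real assume "0 < r"
    then obtain M where M: "\<And>m j. m \<ge> M \<Longrightarrow> (\<Sum>n<j. (cmod (ell2_nth (X m) n - L n))\<^sup>2) \<le> (r/2)\<^sup>2"
      using key[of "r/2"] by auto
    have "norm (X m - Abs_ell2 L) \<le> r/2" if "m \<ge> M" for m
      using M[OF that] \<open>0 < r\<close> by (intro ell2_norm_le) (auto simp: minus_ell2.rep_eq nth)
    with \<open>0 < r\<close> show "\<exists>M. \<forall>m\<ge>M. norm (X m - Abs_ell2 L) < r"
      by (intro exI[of _ M]) (fastforce intro: order_le_less_trans[of _ "r/2"])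
  qed
  then show "convergent X" by (auto simp: convergent_def)
qed

instantiation ell2 :: complex_hilbert_space
begin

lift_definition scaleC_ell2 :: "complex \<Rightarrow> ell2 \<Rightarrow> ell2" is "\<lambda>a x n. a * x n"
  by (rule square_summable_scale)
lift_definition cinner_ell2 :: "ell2 \<Rightarrow> ell2 \<Rightarrow> complex" is "\<lambda>x y. \<Sum>n. x n * cnj (y n)" .

instance
proof
  fix x y z :: ell2 and a b :: complex and r :: real
  show "r *\<^sub>R x = complex_of_real r *\<^sub>C x" by transfer simp
  show "a *\<^sub>C (x + y) = a *\<^sub>C x + a *\<^sub>C y" by transfer (simp add: ring_distribs)
  show "(a + b) *\<^sub>C x = a *\<^sub>C x + b *\<^sub>C x" by transfer (simp add: ring_distribs)
  show "a *\<^sub>C b *\<^sub>C x = (a * b) *\<^sub>C x" by transfer (simp add: mult.assoc)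
  show "cinner x y = cnj (cinner y x)"
  proof transfer
    fix x y :: "nat \<Rightarrow> complex"
    assume "summable (\<lambda>n. (cmod (x n))\<^sup>2)" "summable (\<lambda>n. (cmod (y n))\<^sup>2)"
    then have "(\<lambda>n. y n * cnj (x n)) sums (\<Sum>n. y n * cnj (x n))"
      by (intro summable_sums square_summable_mult)
    then have "(\<lambda>n. cnj (y n * cnj (x n))) sums cnj (\<Sum>n. y n * cnj (x n))"
      by (simp only: sums_cnj)
    then show "(\<Sum>n. x n * cnj (y n)) = cnj (\<Sum>n. y n * cnj (x n))"
      by (simp add: sums_iff mult.commute)
  qed
  show "cinner (x + y) z = cinner x z + cinner y z"
    by transfer (simp add: ring_distribs suminf_add square_summable_mult)
  show "cinner (a *\<^sub>C x) y = a * cinner x y"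
    by transfer (simp add: mult.assoc suminf_mult square_summable_mult)
  show "cinner x x = complex_of_real ((norm x)\<^sup>2)"
    unfolding norm_ell2_power2 cinner_ell2.rep_eq
    by (simp add: suminf_of_real ell2_summable complex_norm_square del: of_real_power)
qed

end

instance ell2 :: separable_complex_hilbert_space
proof
  obtain Q :: "complex set" where Q: "countable Q" "\<And>U. open U \<Longrightarrow> U \<noteq> {} \<Longrightarrow> \<exists>q\<in>Q. q \<in> U"
    using countable_dense_setE by metis
  define f where "f l n = (if n < length l then l ! n else 0)" for l :: "complex list" and n
  have "summable (\<lambda>n. (cmod (f l n))\<^sup>2)" for l
    by (rule summable_finite[of "{..<length l}"]) (auto simp: f_def)
  then have nth: "ell2_nth (Abs_ell2 (f l)) = f l" for l by (simp add: Abs_ell2_inverse)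
  define A where "A = (\<lambda>l. Abs_ell2 (f l)) ` lists Q"
  have "countable A" unfolding A_def using Q(1) by (intro countable_image countable_lists)
  moreover have "\<forall>x. \<forall>e>0. \<exists>y\<in>A. dist y x < e"
  proof -
    have "\<exists>y\<in>A. dist y x < e" if e: "0 < e" for x e
    proof -
      define d where "d = e/2"
      have d: "0 < d" using e by (simp add: d_def)
      obtain N where N: "\<And>n. n \<ge> N \<Longrightarrow> norm (\<Sum>i. (cmod (ell2_nth x (i + n)))\<^sup>2) < d\<^sup>2 / 2"
        using suminf_exist_split[OF _ ell2_summable, of "d\<^sup>2 / 2" x] d by auto
      define c where "c = d\<^sup>2 / (2 * real (Suc N))"
      have c: "0 < c" using d by (simp add: c_def)
      have "\<forall>n. \<exists>q\<in>Q. cmod (q - ell2_nth x n) < sqrt c"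
      proof
        fix n
        have "ball (ell2_nth x n) (sqrt c) \<noteq> {}" using c by simp
        from Q(2)[OF open_ball this] show "\<exists>q\<in>Q. cmod (q - ell2_nth x n) < sqrt c"
          by (auto simp: dist_norm norm_minus_commute)
      qed
      then obtain q where q: "\<And>n. q n \<in> Q" "\<And>n. cmod (q n - ell2_nth x n) < sqrt c" by metis
      define y where "y = Abs_ell2 (f (map q [0..<N]))"
      have "y \<in> A" unfolding A_def y_def using q(1) by (intro imageI) auto
      have ynth: "ell2_nth y n = (if n < N then q n else 0)" for n
        by (simp add: y_def nth f_def)
      have "norm (y - x) \<le> d"
      proof (rule power2_le_imp_le)
        have s: "summable (\<lambda>n. (cmod (ell2_nth (y - x) n))\<^sup>2)" by (rule ell2_summable)
        have "(norm (y - x))\<^sup>2 = (\<Sum>n. (cmod (ell2_nth (y - x) (n + N)))\<^sup>2)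
                + (\<Sum>n<N. (cmod (ell2_nth (y - x) n))\<^sup>2)"
          unfolding norm_ell2_power2 by (rule suminf_split_initial_segment[OF s])
        also have "(\<lambda>n. (cmod (ell2_nth (y - x) (n + N)))\<^sup>2) = (\<lambda>n. (cmod (ell2_nth x (n + N)))\<^sup>2)"
          by (simp add: minus_ell2.rep_eq ynth)
        also have "(\<Sum>n. (cmod (ell2_nth x (n + N)))\<^sup>2) \<le> d\<^sup>2 / 2"
          using N[of N] by (simp add: abs_less_iff)
        also have "(\<Sum>n<N. (cmod (ell2_nth (y - x) n))\<^sup>2) \<le> (\<Sum>n<N. c)"
        proof (rule sum_mono)
          fix n assume "n \<in> {..<N}"
          then have "cmod (ell2_nth (y - x) n) \<le> sqrt c"
            using q(2)[of n] by (simp add: minus_ell2.rep_eq ynth)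
          then have "(cmod (ell2_nth (y - x) n))\<^sup>2 \<le> (sqrt c)\<^sup>2" by (intro power_mono) auto
          then show "(cmod (ell2_nth (y - x) n))\<^sup>2 \<le> c" using c by simp
        qed
        also have "(\<Sum>n<N. c) \<le> d\<^sup>2 / 2"
          unfolding c_def using d by (simp add: field_simps)
        finally show "(norm (y - x))\<^sup>2 \<le> d\<^sup>2" by simp
      qed (use d in simp)
      then have "dist y x < e" using e by (simp add: dist_norm d_def)
      with \<open>y \<in> A\<close> show ?thesis by blast
    qed
    then show ?thesis by blast
  qed
  ultimately show "\<exists>A :: ell2 set. countable A \<and> (\<forall>x. \<forall>e>0. \<exists>y\<in>A. dist y x < e)" by blast
qed


section \<open>Isometric operators and generalized resolvents\<close>

(* An operator with domain D is a pair of a subspace D and a function whose values outside D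
   are irrelevant. *)
definition linear_operator ::
  "'a::complex_hilbert_space set \<Rightarrow> ('a \<Rightarrow> 'b::complex_hilbert_space) \<Rightarrow> bool" where
  "linear_operator D A \<longleftrightarrow> complex_vector.subspace D \<and>
     (\<forall>x\<in>D. \<forall>y\<in>D. A (x + y) = A x + A y) \<and> (\<forall>a. \<forall>x\<in>D. A (a *\<^sub>C x) = a *\<^sub>C A x)"

definition closed_operator ::
  "'a::complex_hilbert_space set \<Rightarrow> ('a \<Rightarrow> 'b::complex_hilbert_space) \<Rightarrow> bool" where
  "closed_operator D A \<longleftrightarrow> linear_operator D A \<and> closed {(x, A x) | x. x \<in> D}"

definition isometric_operator ::
  "'a::complex_hilbert_space set \<Rightarrow> ('a \<Rightarrow> 'b::complex_hilbert_space) \<Rightarrow> bool" where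
  "isometric_operator D A \<longleftrightarrow> linear_operator D A \<and>
     (\<forall>x\<in>D. \<forall>y\<in>D. cinner (A x) (A y) = cinner x y)"

definition unitary_operator :: "('a::complex_hilbert_space \<Rightarrow> 'a) \<Rightarrow> bool" where
  "unitary_operator U \<longleftrightarrow> isometric_operator UNIV U \<and> range U = UNIV"

definition defect_zero :: "'a::complex_hilbert_space set \<Rightarrow> 'a set" where
  "defect_zero D = orthogonal_complement D"

definition defect_infinity ::
  "'a::complex_hilbert_space set \<Rightarrow> ('a \<Rightarrow> 'a) \<Rightarrow> 'a set" where
  "defect_infinity D V = orthogonal_complement (V ` D)"

(* E - zeta A *)
definition resolvent_pencil ::
  "complex \<Rightarrow> ('a::complex_hilbert_space \<Rightarrow> 'a) \<Rightarrow> 'a \<Rightarrow> 'a" where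
  "resolvent_pencil \<zeta> A = (\<lambda>x. x - \<zeta> *\<^sub>C A x)"

(* R is the generalized resolvent of V (with domain D) corresponding to the unitary operator U.
   The space H of V is identified with the closed subspace J H of the larger space by the
   isometry J; accordingly U extends J V J^{-1}, and the projection onto H is the orthogonal
   projection onto J H followed by J^{-1}.  Only the values R zeta with |zeta| ~= 1 matter; for
   these the pencil E - zeta U is a bijection, so inv is its inverse. *)
definition generalized_resolvent_for ::
  "('a::complex_hilbert_space \<Rightarrow> 'b::complex_hilbert_space) \<Rightarrow> ('b \<Rightarrow> 'b) \<Rightarrow>
     'a set \<Rightarrow> ('a \<Rightarrow> 'a) \<Rightarrow> (complex \<Rightarrow> 'a \<Rightarrow> 'a) \<Rightarrow> bool" where
  "generalized_resolvent_for J U D V R \<longleftrightarrow>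
     isometric_operator UNIV J \<and> unitary_operator U \<and> (\<forall>x\<in>D. U (J x) = J (V x)) \<and>
     (\<forall>\<zeta>. cmod \<zeta> \<noteq> 1 \<longrightarrow>
        (\<forall>x. J (R \<zeta> x) = orthogonal_projection (range J) (inv (resolvent_pencil \<zeta> U) (J x))))"

(* The type argument is the larger Hilbert space, since HOL cannot quantify over types inside
   a formula. *)
definition generalized_resolvent ::
  "'b::separable_complex_hilbert_space itself \<Rightarrow> 'a::separable_complex_hilbert_space set \<Rightarrow>
     ('a \<Rightarrow> 'a) \<Rightarrow> (complex \<Rightarrow> 'a \<Rightarrow> 'a) \<Rightarrow> bool" where
  "generalized_resolvent (_ :: 'b itself) D V R \<longleftrightarrow>
     (\<exists>(J :: 'a \<Rightarrow> 'b) U. generalized_resolvent_for J U D V R)"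


section \<open>Analytic functions with contractive values\<close>

(* Complex differentiability in the operator norm of the bounded operators from N to N'. *)
definition operator_analytic_on ::
  "(complex \<Rightarrow> 'a::complex_hilbert_space \<Rightarrow> 'b::complex_hilbert_space) \<Rightarrow> complex set \<Rightarrow>
     'a set \<Rightarrow> 'b set \<Rightarrow> bool" where
  "operator_analytic_on F \<Omega> N N' \<longleftrightarrow>
     (\<forall>z\<in>\<Omega>. \<exists>G. linear_operator N G \<and> G ` N \<subseteq> N' \<and> (\<exists>C. \<forall>x\<in>N. norm (G x) \<le> C * norm x) \<and>
        (\<forall>e>0. \<forall>\<^sub>F w in at z. \<forall>x\<in>N.
           norm (inverse (w - z) *\<^sub>C (F w x - F z x) - G x) \<le> e * norm x))"

definition schur_class ::
  "complex set \<Rightarrow> 'a::complex_hilbert_space set \<Rightarrow> 'b::complex_hilbert_space set \<Rightarrow>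
     (complex \<Rightarrow> 'a \<Rightarrow> 'b) set" where
  "schur_class \<Omega> N N' = {F. operator_analytic_on F \<Omega> N N' \<and>
     (\<forall>z\<in>\<Omega>. linear_operator N (F z) \<and> F z ` N \<subseteq> N' \<and> (\<forall>x\<in>N. norm (F z x) \<le> norm x))}"

(* The operator equal to A on D and to B on the orthogonal complement of D. *)
definition direct_sum_operator ::
  "'a::complex_hilbert_space set \<Rightarrow> ('a \<Rightarrow> 'b::complex_hilbert_space) \<Rightarrow> ('a \<Rightarrow> 'b) \<Rightarrow> 'a \<Rightarrow> 'b" where
  "direct_sum_operator D A B h =
     A (orthogonal_projection D h) + B (orthogonal_projection (orthogonal_complement D) h)"

(* The representation of R on the unit disc by the parameter F; bij makes inv a true inverse. *)
definition resolvent_formula ::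
  "'a::complex_hilbert_space set \<Rightarrow> ('a \<Rightarrow> 'a) \<Rightarrow> (complex \<Rightarrow> 'a \<Rightarrow> 'a) \<Rightarrow>
     (complex \<Rightarrow> 'a \<Rightarrow> 'a) \<Rightarrow> bool" where
  "resolvent_formula D V F R \<longleftrightarrow>
     (\<forall>\<zeta>\<in>ball 0 1. bij (resolvent_pencil \<zeta> (direct_sum_operator D V (F \<zeta>))) \<and>
        R \<zeta> = inv (resolvent_pencil \<zeta> (direct_sum_operator D V (F \<zeta>))))"

end

theory Submission
  imports Defs "HOL-Complex_Analysis.Complex_Analysis"
begin

text \<open>If \<open>U\<close> is a unitary extension and \<open>P\<close> the projection onto \<open>H\<close>, then
  \<open>W z = P U (1 - z (1 - P) U)\<^sup>-\<^sup>1\<close>, restricted to \<open>H\<close>, is an analytic family of contractions that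
  coincides with \<open>V\<close> on its domain, and the generalized resolvent is \<open>(1 - z W z)\<^sup>-\<^sup>1\<close> by a Schur
  complement computation.

  Conversely, let \<open>T z\<close> be the direct sum of \<open>V\<close> and \<open>F z\<close>, and let \<open>C\<^sub>n\<close> be the Taylor coefficients of
  \<open>R z = (1 - z T z)\<^sup>-\<^sup>1\<close>. As \<open>R z + (R z)\<^sup>* - 1 \<ge> 0\<close>, the Toeplitz kernel \<open>C\<^sub>n\<^sub>-\<^sub>m\<close> (with \<open>C\<^sub>-\<^sub>n = C\<^sub>n\<^sup>*\<close>) is
  positive, so it is the Gram matrix of vectors in the sequence space. The index shift on their closed span is
  the required unitary operator: it satisfies \<open>P U\<^sup>n = C\<^sub>n\<close> on \<open>H\<close>, and it extends \<open>V\<close> because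
  \<open>C\<^sub>1 = T 0\<close> is isometric on the domain of \<open>V\<close>. Outside the disc the resolvents are determined by
  reflection.\<close>

section \<open>Hilbert space geometry\<close>

text \<open>Positivity of \<open>R z + (R z)^* - 1\<close> passes to the Toeplitz kernel by
  integration. On the circle of radius \<open>r < 1\<close> the Fourier coefficients of this form
  are \<open>r^|n| C_n\<close>, so testing it on a vector-valued trigonometric polynomial and
  integrating gives the kernel damped by \<open>r^|n|\<close>. Only afterwards does \<open>r\<close>
  tend to 1, inside a finite sum, so no boundary values enter. The space carrying \<open>U\<close>
  has to be one fixed space for all \<open>V\<close> and \<open>F\<close>. Separability lets the
  kernel live on countably many pairs \<open>(n, i)\<close>, where \<open>i\<close> numbers a dense
  sequence, and a triangular factorisation has finitely supported rows, so the vectors land in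
  \<open>ell2\<close> without quotient or completion. The index \<open>n\<close> runs over all
  integers because the two-sided shift maps the span onto itself; a one-sided shift would in general
  only be isometric. The point 0 is special for uniqueness: the resolvent there is the identity
  whatever \<open>F 0\<close> is, so \<open>F 0\<close> is recovered by continuity.\<close>

lemma cinner_add_right: "cinner x (y + z) = cinner x y + cinner x (z :: 'a::complex_hilbert_space)"
  by (metis cinner_add_left cinner_commute complex_cnj_add)

lemma cinner_scaleC_right: "cinner x (a *\<^sub>C y) = cnj a * cinner x (y :: 'a::complex_hilbert_space)"
  by (metis cinner_scaleC_left cinner_commute complex_cnj_mult)

lemma scaleC_minus_one: "(- 1) *\<^sub>C x = - (x :: 'a::complex_hilbert_space)"
  using scaleR_scaleC[of "- 1" x] by simp

lemma cinner_minus_left: "cinner (- x) y = - cinner x (y :: 'a::complex_hilbert_space)"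
  by (metis cinner_scaleC_left mult_minus1 scaleC_minus_one)

lemma cinner_minus_right: "cinner x (- y) = - cinner x (y :: 'a::complex_hilbert_space)"
  by (metis cinner_commute cinner_minus_left complex_cnj_minus)

lemma cinner_diff_left: "cinner (x - y) z = cinner x z - cinner y (z :: 'a::complex_hilbert_space)"
  by (simp only: diff_conv_add_uminus cinner_add_left cinner_minus_left)

lemma cinner_diff_right: "cinner x (y - z) = cinner x y - cinner x (z :: 'a::complex_hilbert_space)"
  by (simp only: diff_conv_add_uminus cinner_add_right cinner_minus_right)

lemma cinner_zero_left [simp]: "cinner 0 y = 0"
  using cinner_diff_left[of 0 0 y] by simp

lemma cinner_zero_right [simp]: "cinner x 0 = 0"
  using cinner_diff_right[of x 0 0] by simp

lemma cinner_sum_left: "cinner (sum f S) y = (\<Sum>i\<in>S. cinner (f i) y)"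
  by (induction S rule: infinite_finite_induct) (auto simp: cinner_add_left)

lemma cinner_sum_right: "cinner y (sum f S) = (\<Sum>i\<in>S. cinner y (f i))"
  by (induction S rule: infinite_finite_induct) (auto simp: cinner_add_right)

lemmas cinner_linear = cinner_add_left cinner_add_right cinner_diff_left cinner_diff_right
  cinner_scaleC_left cinner_scaleC_right cinner_sum_left cinner_sum_right

lemma norm_sq_cinner: "(norm x)\<^sup>2 = Re (cinner x x)"
  by (simp add: cinner_same)

lemma norm_scaleC [simp]: "norm (a *\<^sub>C x) = cmod a * norm (x :: 'a::complex_hilbert_space)"
proof -
  have "complex_of_real ((norm (a *\<^sub>C x))\<^sup>2) = complex_of_real ((cmod a * norm x)\<^sup>2)"
    by (simp add: cinner_same[symmetric] cinner_linear power_mult_distrib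
        complex_norm_square mult_ac del: of_real_power)
  then have "(norm (a *\<^sub>C x))\<^sup>2 = (cmod a * norm x)\<^sup>2" by (simp only: of_real_eq_iff)
  then show ?thesis by (simp add: power2_eq_iff_nonneg)
qed

lemma norm_add_sq:
  "(norm (x + y))\<^sup>2 = (norm x)\<^sup>2 + 2 * Re (cinner x y) + (norm (y :: 'a::complex_hilbert_space))\<^sup>2"
  using arg_cong[OF cinner_commute[of y x], of Re] by (simp add: norm_sq_cinner cinner_linear)

lemma norm_diff_sq:
  "(norm (x - y))\<^sup>2 = (norm x)\<^sup>2 - 2 * Re (cinner x y) + (norm (y :: 'a::complex_hilbert_space))\<^sup>2"
  using arg_cong[OF cinner_commute[of y x], of Re] by (simp add: norm_sq_cinner cinner_linear)

text \<open>Pythagoras for the part of \<open>x\<close> orthogonal to \<open>s\<close>. It yields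
  both the Cauchy-Schwarz inequality and the orthogonality of the best approximation error.\<close>

lemma norm_diff_projection:
  fixes x s :: "'a::complex_hilbert_space"
  assumes "s \<noteq> 0"
  shows "(norm (x - (cinner x s / cinner s s) *\<^sub>C s))\<^sup>2
    = (norm x)\<^sup>2 - (cmod (cinner x s))\<^sup>2 / (norm s)\<^sup>2"
proof -
  let ?l = "cinner x s / cinner s s"
  have "Re (cinner x (?l *\<^sub>C s)) = (cmod (cinner x s))\<^sup>2 / (norm s)\<^sup>2"
    by (simp add: cinner_linear cinner_same complex_norm_square[symmetric] mult.commute
        flip: of_real_power)
  moreover have "(norm (?l *\<^sub>C s))\<^sup>2 = (cmod (cinner x s))\<^sup>2 / (norm s)\<^sup>2"
    using assms by (simp add: cinner_same norm_divide norm_mult power2_eq_square)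
  ultimately show ?thesis by (simp add: norm_diff_sq)
qed

lemma cinner_Cauchy_Schwarz:
  "cmod (cinner x y) \<le> norm x * norm (y :: 'a::complex_hilbert_space)"
proof (cases "y = 0")
  case False
  have "0 \<le> (norm x)\<^sup>2 - (cmod (cinner x y))\<^sup>2 / (norm y)\<^sup>2"
    using norm_diff_projection[OF False, of x] by (metis zero_le_power2)
  then have "(cmod (cinner x y))\<^sup>2 \<le> (norm x * norm y)\<^sup>2"
    using False by (simp add: field_simps power_mult_distrib)
  then show ?thesis by (rule power2_le_imp_le) simp
qed simp

lemma bounded_bilinear_cinner:
  "bounded_bilinear (cinner :: 'a::complex_hilbert_space \<Rightarrow> 'a \<Rightarrow> complex)"
proof
  fix x y z :: 'a and r :: real
  show "cinner (r *\<^sub>R x) y = r *\<^sub>R cinner x y"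
    by (simp add: scaleR_scaleC cinner_linear scaleR_conv_of_real)
  show "cinner x (r *\<^sub>R y) = r *\<^sub>R cinner x y"
    by (simp add: scaleR_scaleC cinner_linear scaleR_conv_of_real)
  show "\<exists>K. \<forall>x y :: 'a. norm (cinner x y) \<le> norm x * norm y * K"
    by (intro exI[of _ 1]) (simp add: cinner_Cauchy_Schwarz)
qed (simp_all add: cinner_linear)

lemma bounded_bilinear_scaleC:
  "bounded_bilinear (scaleC :: complex \<Rightarrow> 'a::complex_hilbert_space \<Rightarrow> 'a)"
proof
  fix a b :: complex and x y :: 'a and r :: real
  show "(a + b) *\<^sub>C x = a *\<^sub>C x + b *\<^sub>C x" "a *\<^sub>C (x + y) = a *\<^sub>C x + a *\<^sub>C y"
    by (simp_all add: scaleC_add_left scaleC_add_right)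
  show "(r *\<^sub>R a) *\<^sub>C x = r *\<^sub>R a *\<^sub>C x" "a *\<^sub>C r *\<^sub>R x = r *\<^sub>R a *\<^sub>C x"
    by (simp_all add: scaleR_scaleC scaleC_scaleC scaleR_conv_of_real mult.commute)
  show "\<exists>K. \<forall>a (x :: 'a). norm (a *\<^sub>C x) \<le> norm a * norm x * K"
    by (intro exI[of _ 1]) simp
qed

lemmas tendsto_cinner [tendsto_intros] = bounded_bilinear.tendsto[OF bounded_bilinear_cinner]
lemmas tendsto_scaleC [tendsto_intros] = bounded_bilinear.tendsto[OF bounded_bilinear_scaleC]
lemmas continuous_on_cinner [continuous_intros] =
  bounded_bilinear.continuous_on[OF bounded_bilinear_cinner]

lemma scaleC_zero_left [simp]: "0 *\<^sub>C x = (0 :: 'a::complex_hilbert_space)"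
  by (rule complex_vector.scale_zero_left)

lemma scaleC_zero_right [simp]: "a *\<^sub>C 0 = (0 :: 'a::complex_hilbert_space)"
  by (rule complex_vector.scale_zero_right)

lemmas scaleC_linear = scaleC_add_left scaleC_add_right scaleC_scaleC
  complex_vector.scale_left_diff_distrib complex_vector.scale_right_diff_distrib

lemma cinner_ext:
  assumes "\<And>y. cinner x y = cinner z (y :: 'a::complex_hilbert_space)"
  shows "x = z"
proof -
  have "cinner (x - z) (x - z) = 0" by (simp add: cinner_diff_left assms)
  then show ?thesis by (simp add: cinner_same)
qed

text \<open>The shape \<open>e * c\<close>, with \<open>c\<close> a norm, fits
  \<open>operator_analytic_on\<close>: it turns the uniform operator bound into a limit at a single
  vector.\<close>

lemma tendsto_of_norm_bound:
  fixes l :: "'a::real_normed_vector"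
  assumes "\<And>e. e > 0 \<Longrightarrow> \<forall>\<^sub>F w in A. norm (f w - l) \<le> e * c" and "c \<ge> 0"
  shows "(f \<longlongrightarrow> l) A"
proof (rule tendstoI)
  fix e :: real assume e: "e > 0"
  \<comment> \<open>The bound \<open>c\<close> may be 0, hence the shift by 1 before
    dividing.\<close>
  have "c + 1 > 0" using assms(2) by simp
  then have le: "e / (c + 1) * c < e" using e by (simp add: field_simps)
  have "\<forall>\<^sub>F w in A. norm (f w - l) \<le> e / (c + 1) * c"
    using e \<open>c + 1 > 0\<close> by (intro assms) simp
  then show "\<forall>\<^sub>F w in A. dist (f w) l < e"
    by eventually_elim (use le in \<open>simp only: dist_norm\<close>)
qed

section \<open>Orthogonal projections\<close>

text \<open>A sequence minimising the squared distance is Cauchy; \<open>d\<close> is the infimum of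
  the squares.\<close>

lemma best_approximation_exists:
  fixes S :: "'a::complex_hilbert_space set"
  assumes S: "complex_vector.subspace S" and "closed S"
  shows "\<exists>y\<in>S. \<forall>s\<in>S. norm (x - y) \<le> norm (x - s)"
proof -
  define d where "d = Inf ((\<lambda>s. (norm (x - s))\<^sup>2) ` S)"
  have bdd: "bdd_below ((\<lambda>s. (norm (x - s))\<^sup>2) ` S)" by (rule bdd_belowI[of _ 0]) auto
  have ne: "S \<noteq> {}" using complex_vector.subspace_0[OF S] by auto
  have d: "d \<le> (norm (x - s))\<^sup>2" if "s \<in> S" for s
    unfolding d_def using bdd that by (intro cINF_lower)
  have "\<exists>s\<in>S. (norm (x - s))\<^sup>2 < d + e" if "e > 0" for e
    using cINF_less_iff[OF ne bdd, of "d + e"] that by (auto simp: d_def)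
  then have "\<forall>n. \<exists>s\<in>S. (norm (x - s))\<^sup>2 < d + inverse (real (Suc n))" by auto
  then obtain s where sS: "\<And>n. s n \<in> S"
    and s: "\<And>n. (norm (x - s n))\<^sup>2 < d + inverse (real (Suc n))" by metis
  \<comment> \<open>Parallelogram law: the midpoint of \<open>s n\<close> and \<open>s m\<close>
    lies in \<open>S\<close>, so the sum of the two differences has squared norm at least
    \<open>4 * d\<close>. With \<open>e = 1 / (N + 1)\<close> this leaves
    \<open>2 * (d + e) + 2 * (d + e) - 4 * d = 4 * e\<close>.\<close>
  have dist: "(norm (s n - s m))\<^sup>2 \<le> 4 * inverse (real (Suc N))" if "n \<ge> N" "m \<ge> N" for n m N
  proof -
    let ?p = "x - s n" and ?q = "x - s m"
    have h: "(1/2) *\<^sub>C (s n + s m) \<in> S"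
      using S sS by (simp add: complex_vector.subspace_add complex_vector.subspace_scale)
    have "(1/2) *\<^sub>R (?p + ?q) = x - (1/2) *\<^sub>C (s n + s m)"
      using scaleR_scaleC[of "1/2" "s n + s m"]
      by (simp add: algebra_simps flip: scaleR_add_left)
    then have "d \<le> (norm ((1/2) *\<^sub>R (?p + ?q)))\<^sup>2" using d[OF h] by simp
    then have "4 * d \<le> (norm (?p + ?q))\<^sup>2" by (simp add: power2_eq_square)
    moreover have "(norm (s n - s m))\<^sup>2 = (norm (?q - ?p))\<^sup>2" by simp
    moreover have "(norm (?q - ?p))\<^sup>2 + (norm (?q + ?p))\<^sup>2 = 2 * (norm ?p)\<^sup>2 + 2 * (norm ?q)\<^sup>2"
      using norm_add_sq[of ?q ?p] norm_diff_sq[of ?q ?p] by linarith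
    moreover have "inverse (real (Suc n)) \<le> inverse (real (Suc N))"
      "inverse (real (Suc m)) \<le> inverse (real (Suc N))" using that by simp_all
    ultimately show ?thesis using s[of n] s[of m] unfolding add.commute[of ?q ?p] by linarith
  qed
  have "Cauchy s"
  proof (rule CauchyI)
    fix e :: real assume e: "0 < e"
    obtain N where N: "inverse (real (Suc N)) < e\<^sup>2 / 4" using e reals_Archimedean[of "e\<^sup>2/4"] by auto
    have "norm (s n - s m) < e" if "n \<ge> N" "m \<ge> N" for n m
    proof (rule power2_less_imp_less)
      show "(norm (s n - s m))\<^sup>2 < e\<^sup>2" using dist[OF that] N by simp
    qed (use e in simp)
    then show "\<exists>N. \<forall>m\<ge>N. \<forall>n\<ge>N. norm (s m - s n) < e" by blast
  qed
  then obtain y where y: "s \<longlonglongrightarrow> y" by (auto simp: Cauchy_convergent_iff convergent_def)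
  have "y \<in> S" using \<open>closed S\<close> sS y by (rule closed_sequentially)
  moreover have "norm (x - y) \<le> norm (x - t)" if t: "t \<in> S" for t
  proof (rule power2_le_imp_le)
    have "(\<lambda>n. d + inverse (real (Suc n))) \<longlonglongrightarrow> d + 0"
      by (intro tendsto_intros LIMSEQ_inverse_real_of_nat)
    moreover have "(\<lambda>n. (norm (x - s n))\<^sup>2) \<longlonglongrightarrow> (norm (x - y))\<^sup>2" by (intro tendsto_intros y)
    ultimately have "(norm (x - y))\<^sup>2 \<le> d"
      using s by (intro LIMSEQ_le[of "\<lambda>n. (norm (x - s n))\<^sup>2"]) (auto intro: less_imp_le)
    then show "(norm (x - y))\<^sup>2 \<le> (norm (x - t))\<^sup>2" using d[OF t] by (rule order_trans)
  qed simp
  ultimately show ?thesis by blast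
qed

text \<open>If the error of the best approximation \<open>y\<close> were not orthogonal to some
  \<open>s\<close>, moving \<open>y\<close> by the component of the error along \<open>s\<close>
  would shorten it.\<close>

lemma orthogonal_projection_exists:
  fixes S :: "'a::complex_hilbert_space set"
  assumes S: "complex_vector.subspace S" and "closed S"
  shows "\<exists>!y. y \<in> S \<and> x - y \<in> orthogonal_complement S"
proof (rule ex_ex1I)
  obtain y where y: "y \<in> S" "\<And>s. s \<in> S \<Longrightarrow> norm (x - y) \<le> norm (x - s)"
    using best_approximation_exists[OF assms] by blast
  have "cinner (x - y) s = 0" if s: "s \<in> S" for s
  proof (cases "s = 0")
    case False
    let ?l = "cinner (x - y) s / cinner s s"
    have "y + ?l *\<^sub>C s \<in> S"
      using S y(1) s by (simp add: complex_vector.subspace_add complex_vector.subspace_scale)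
    from y(2)[OF this] have "(norm (x - y))\<^sup>2 \<le> (norm (x - y - ?l *\<^sub>C s))\<^sup>2"
      by (intro power_mono) (simp_all add: diff_diff_add)
    then have "(cmod (cinner (x - y) s))\<^sup>2 / (norm s)\<^sup>2 \<le> 0"
      by (simp add: norm_diff_projection[OF False])
    then show ?thesis using False by (simp add: divide_le_0_iff)
  qed simp
  with y(1) show "\<exists>y. y \<in> S \<and> x - y \<in> orthogonal_complement S"
    by (auto simp: orthogonal_complement_def)
next
  fix y z
  assume y: "y \<in> S \<and> x - y \<in> orthogonal_complement S" and z: "z \<in> S \<and> x - z \<in> orthogonal_complement S"
  have yz: "y - z \<in> S" using S y z by (simp add: complex_vector.subspace_diff)
  have "cinner (y - z) (y - z) = cinner (x - z) (y - z) - cinner (x - y) (y - z)"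
    by (simp flip: cinner_diff_left)
  also have "\<dots> = 0" using y z yz by (simp add: orthogonal_complement_def)
  finally show "y = z" by (simp add: cinner_same)
qed

lemma orthogonal_projection_eqI:
  fixes S :: "'a::complex_hilbert_space set"
  assumes "complex_vector.subspace S" "closed S" "y \<in> S" "\<And>s. s \<in> S \<Longrightarrow> cinner x s = cinner y s"
  shows "orthogonal_projection S x = y"
  unfolding orthogonal_projection_def using assms
  by (intro the1_equality[OF orthogonal_projection_exists])
     (auto simp: orthogonal_complement_def cinner_diff_left)

lemma
  fixes S :: "'a::complex_hilbert_space set"
  assumes "complex_vector.subspace S" "closed S"
  shows orthogonal_projection_in: "orthogonal_projection S x \<in> S"
    and diff_orthogonal_projection_in: "x - orthogonal_projection S x \<in> orthogonal_complement S"
  using theI'[OF orthogonal_projection_exists[OF assms, of x]]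
  unfolding orthogonal_projection_def by auto

lemma cinner_orthogonal_projection:
  fixes S :: "'a::complex_hilbert_space set"
  assumes "complex_vector.subspace S" "closed S" "s \<in> S"
  shows "cinner (orthogonal_projection S x) s = cinner x s"
  using diff_orthogonal_projection_in[OF assms(1,2), of x] assms(3)
  by (simp add: orthogonal_complement_def cinner_diff_left)

lemma orthogonal_projection_ident:
  assumes "complex_vector.subspace S" "closed S" "x \<in> S"
  shows "orthogonal_projection S x = x"
  by (rule orthogonal_projection_eqI[OF assms refl])

lemma orthogonal_projection_linear:
  fixes S :: "'a::complex_hilbert_space set"
  assumes S: "complex_vector.subspace S" "closed S"
  shows "linear_operator UNIV (orthogonal_projection S)"
  unfolding linear_operator_def
  using S by (auto intro!: orthogonal_projection_eqI orthogonal_projection_in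
      complex_vector.subspace_add complex_vector.subspace_scale
      simp: cinner_linear cinner_orthogonal_projection)

lemma norm_orthogonal_split:
  fixes S :: "'a::complex_hilbert_space set"
  assumes S: "complex_vector.subspace S" "closed S"
  shows "(norm x)\<^sup>2 = (norm (orthogonal_projection S x))\<^sup>2 + (norm (x - orthogonal_projection S x))\<^sup>2"
proof -
  let ?p = "orthogonal_projection S x"
  have "cinner (x - ?p) ?p = 0"
    using diff_orthogonal_projection_in[OF S] orthogonal_projection_in[OF S]
    by (auto simp: orthogonal_complement_def)
  then show ?thesis using norm_add_sq[of "x - ?p" ?p] by simp
qed

lemma norm_orthogonal_projection_le:
  fixes S :: "'a::complex_hilbert_space set"
  assumes S: "complex_vector.subspace S" "closed S"
  shows "norm (orthogonal_projection S x) \<le> norm x" "norm (x - orthogonal_projection S x) \<le> norm x"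
  using norm_orthogonal_split[OF S, of x] by (auto intro: power2_le_imp_le)

lemma subspace_orthogonal_complement: "complex_vector.subspace (orthogonal_complement S)"
  by (auto simp: complex_vector.subspace_def orthogonal_complement_def cinner_linear)

lemma closed_orthogonal_complement: "closed (orthogonal_complement S)"
proof -
  have "orthogonal_complement S = (\<Inter>y\<in>S. {x. cinner x y = 0})"
    by (auto simp: orthogonal_complement_def)
  also have "closed \<dots>" by (intro closed_INT ballI closed_Collect_eq continuous_intros)
  finally show ?thesis .
qed

lemma orthogonal_projection_complement:
  fixes S :: "'a::complex_hilbert_space set"
  assumes S: "complex_vector.subspace S" "closed S"
  shows "orthogonal_projection (orthogonal_complement S) x = x - orthogonal_projection S x"
proof (rule orthogonal_projection_eqI)
  fix s assume "s \<in> orthogonal_complement S"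
  then have "cinner s (orthogonal_projection S x) = 0"
    using orthogonal_projection_in[OF S] by (auto simp: orthogonal_complement_def)
  then show "cinner x s = cinner (x - orthogonal_projection S x) s"
    using cinner_commute[of "orthogonal_projection S x" s] by (simp add: cinner_diff_left)
qed (use S in \<open>auto simp: subspace_orthogonal_complement closed_orthogonal_complement
    intro: diff_orthogonal_projection_in\<close>)

section \<open>Contractions, isometries and their resolvents\<close>

definition contraction :: "('a::complex_hilbert_space \<Rightarrow> 'b::complex_hilbert_space) \<Rightarrow> bool" where
  "contraction T \<longleftrightarrow> linear_operator UNIV T \<and> (\<forall>x. norm (T x) \<le> norm x)"

lemma linear_operator_UNIV:
  "linear_operator UNIV T \<longleftrightarrow> (\<forall>x y. T (x + y) = T x + T y) \<and> (\<forall>a x. T (a *\<^sub>C x) = a *\<^sub>C T x)"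
  by (simp add: linear_operator_def)

lemma linear_operator_zero: "linear_operator D T \<Longrightarrow> T 0 = 0"
  using complex_vector.subspace_0[of D] scaleC_zero_left[of 0]
  by (metis linear_operator_def scaleC_zero_left)

lemma linear_operator_diff:
  assumes "linear_operator D T" "x \<in> D" "y \<in> D"
  shows "T (x - y) = T x - T y"
proof -
  have D: "complex_vector.subspace D" using assms by (simp add: linear_operator_def)
  have "x - y = x + (- 1) *\<^sub>C y" by (simp add: scaleC_minus_one)
  moreover have "(- 1) *\<^sub>C y \<in> D" using D assms(3) by (rule complex_vector.subspace_scale)
  ultimately have "T (x - y) = T x + T ((- 1) *\<^sub>C y)"
    using assms(1,2) unfolding linear_operator_def \<open>x - y = x + (- 1) *\<^sub>C y\<close> by blast
  also have "T ((- 1) *\<^sub>C y) = (- 1) *\<^sub>C T y"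
    using assms(1,3) unfolding linear_operator_def by blast
  finally show ?thesis by (simp add: scaleC_minus_one)
qed

lemma contraction_add: "contraction T \<Longrightarrow> T (x + y) = T x + T y"
  and contraction_scaleC: "contraction T \<Longrightarrow> T (a *\<^sub>C x) = a *\<^sub>C T x"
  and contraction_norm: "contraction T \<Longrightarrow> norm (T x) \<le> norm x"
  by (auto simp: contraction_def linear_operator_UNIV)

lemma contraction_diff: "contraction T \<Longrightarrow> T (x - y) = T x - T y"
  by (auto simp: contraction_def intro: linear_operator_diff)

lemma contraction_zero: "contraction T \<Longrightarrow> T 0 = 0"
  by (auto simp: contraction_def intro: linear_operator_zero)

lemma contraction_sum: "contraction T \<Longrightarrow> T (sum f S) = (\<Sum>i\<in>S. T (f i))"
  by (induction S rule: infinite_finite_induct) (simp_all add: contraction_zero contraction_add)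

lemmas contraction_linear = contraction_add contraction_diff contraction_scaleC contraction_sum

lemma contractionI:
  assumes "\<And>x y. T (x + y) = T x + T y" "\<And>a x. T (a *\<^sub>C x) = a *\<^sub>C T x" "\<And>x. norm (T x) \<le> norm x"
  shows "contraction T"
  using assms by (simp add: contraction_def linear_operator_UNIV)

lemma contraction_bounded_linear:
  assumes "contraction T"
  shows "bounded_linear T"
proof (rule bounded_linear_intro[of _ 1])
  show "T (r *\<^sub>R x) = r *\<^sub>R T x" for r x
    using assms by (simp add: scaleR_scaleC contraction_scaleC)
qed (use assms in \<open>simp_all add: contraction_add contraction_norm\<close>)

lemma contraction_comp: "contraction S \<Longrightarrow> contraction T \<Longrightarrow> contraction (\<lambda>x. S (T x))"
  by (rule contractionI) (auto simp: contraction_linear intro: order_trans[OF contraction_norm contraction_norm])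

section \<open>Resolvents of contractions at points of the disc\<close>

definition resolvent :: "complex \<Rightarrow> ('a::complex_hilbert_space \<Rightarrow> 'a) \<Rightarrow> 'a \<Rightarrow> 'a" where
  "resolvent z T = inv (resolvent_pencil z T)"

context
  fixes T :: "'a::complex_hilbert_space \<Rightarrow> 'a" and z :: complex
  assumes T: "contraction T" and z: "cmod z < 1"
begin

text \<open>Solving \<open>u - z T u = y\<close> is a fixed point problem for
  \<open>y + z T u\<close>, whose Lipschitz constant is at most \<open>cmod z < 1\<close>.\<close>

lemma bij_resolvent_pencil: "bij (resolvent_pencil z T)"
proof -
  have "\<exists>!u. y + z *\<^sub>C T u = u" for y
  proof (rule banach_fix_type[of "cmod z"])
    have "y + z *\<^sub>C T u - (y + z *\<^sub>C T v) = z *\<^sub>C T (u - v)" for u v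
      by (simp add: contraction_diff[OF T] scaleC_linear)
    then show "\<forall>u v. dist (y + z *\<^sub>C T u) (y + z *\<^sub>C T v) \<le> cmod z * dist u v"
      using contraction_norm[OF T] by (simp add: dist_norm mult_left_mono)
  qed (use z in auto)
  then have "\<exists>!u. resolvent_pencil z T u = y" for y
    by (simp add: resolvent_pencil_def algebra_simps eq_commute)
  then show ?thesis by (auto simp: bij_iff)
qed

text \<open>The working tool for identities between resolvents: it is enough to check the fixed
  point equation for a candidate.\<close>

lemma resolvent_eqI: "u = y + z *\<^sub>C T u \<Longrightarrow> resolvent z T y = u"
  unfolding resolvent_def
  by (rule inv_f_eq) (use bij_resolvent_pencil in \<open>auto simp: bij_is_inj resolvent_pencil_def algebra_simps\<close>)

lemma resolvent_eq: "resolvent z T y = y + z *\<^sub>C T (resolvent z T y)"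
proof -
  have "resolvent_pencil z T (resolvent z T y) = y"
    unfolding resolvent_def by (rule surj_f_inv_f) (rule bij_is_surj[OF bij_resolvent_pencil])
  then show ?thesis by (simp add: resolvent_pencil_def algebra_simps)
qed

lemma resolvent_add: "resolvent z T (x + y) = resolvent z T x + resolvent z T y"
proof (rule resolvent_eqI)
  have "resolvent z T x + resolvent z T y
      = (x + z *\<^sub>C T (resolvent z T x)) + (y + z *\<^sub>C T (resolvent z T y))"
    by (rule arg_cong2[OF resolvent_eq resolvent_eq, where f = "(+)"])
  also have "\<dots> = x + y + z *\<^sub>C T (resolvent z T x + resolvent z T y)"
    by (simp add: contraction_linear[OF T] scaleC_linear)
  finally show "resolvent z T x + resolvent z T y = \<dots>" .
qed

lemma resolvent_scaleC: "resolvent z T (a *\<^sub>C x) = a *\<^sub>C resolvent z T x"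
proof (rule resolvent_eqI)
  have "a *\<^sub>C resolvent z T x = a *\<^sub>C (x + z *\<^sub>C T (resolvent z T x))"
    by (rule arg_cong[OF resolvent_eq])
  also have "\<dots> = a *\<^sub>C x + z *\<^sub>C T (a *\<^sub>C resolvent z T x)"
    by (simp add: contraction_linear[OF T] scaleC_linear mult.commute)
  finally show "a *\<^sub>C resolvent z T x = \<dots>" .
qed

lemma norm_resolvent_le: "norm (resolvent z T y) \<le> norm y / (1 - cmod z)"
proof -
  have "norm (resolvent z T y) \<le> norm y + norm (z *\<^sub>C T (resolvent z T y))"
    using resolvent_eq[of y] norm_triangle_ineq by metis
  also have "\<dots> \<le> norm y + cmod z * norm (resolvent z T y)"
    using contraction_norm[OF T] by (simp add: mult_left_mono)
  finally show ?thesis using z by (simp add: field_simps)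
qed

lemma bounded_linear_resolvent: "bounded_linear (resolvent z T)"
  by (rule bounded_linear_intro[of _ "1 / (1 - cmod z)"])
     (use norm_resolvent_le in \<open>auto simp: resolvent_add resolvent_scaleC scaleR_scaleC\<close>)

end

text \<open>The second resolvent identity with point and operator both varying: \<open>(1 - wA)^-1 -
  (1 - zB)^-1 = (1 - wA)^-1 (wA - zB) (1 - zB)^-1\<close>. The continuity and differentiability
  arguments below rest on it.\<close>

lemma resolvent_difference:
  assumes A: "contraction A" "cmod w < 1" and B: "contraction B" "cmod z < 1"
  shows "resolvent w A y - resolvent z B y
    = resolvent w A (w *\<^sub>C A (resolvent z B y) - z *\<^sub>C B (resolvent z B y))"
proof -
  define v where "v = resolvent z B y"
  define g where "g = resolvent w A (w *\<^sub>C A v - z *\<^sub>C B v)"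
  have v: "v = y + z *\<^sub>C B v" using resolvent_eq[OF B, of y] by (simp add: v_def)
  have g: "g = w *\<^sub>C A v - z *\<^sub>C B v + w *\<^sub>C A g" using resolvent_eq[OF A] by (simp add: g_def)
  have "v + g = (y + z *\<^sub>C B v) + (w *\<^sub>C A v - z *\<^sub>C B v + w *\<^sub>C A g)"
    using v g by (rule arg_cong2[where f = "(+)"])
  also have "\<dots> = y + w *\<^sub>C A (v + g)"
    by (simp add: contraction_linear[OF A(1)] scaleC_linear)
  finally have "v + g = y + w *\<^sub>C A (v + g)" .
  from resolvent_eqI[OF A this] show ?thesis by (simp add: v_def g_def)
qed

text \<open>The first resolvent sends \<open>x - z A x\<close> to \<open>x\<close>, hence so does
  the second. At \<open>z = 0\<close> both resolvents are the identity, so that point is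
  excluded.\<close>

lemma resolvent_inject:
  assumes A: "contraction A" "contraction B" "cmod z < 1" "z \<noteq> 0"
    and eq: "\<And>y. resolvent z A y = resolvent z B y"
  shows "A x = B x"
proof -
  let ?y = "x - z *\<^sub>C A x"
  have 1: "resolvent z A ?y = x" using A by (intro resolvent_eqI) auto
  then have "resolvent z B ?y = x" using eq by simp
  then have "x = ?y + z *\<^sub>C B x" using resolvent_eq[OF A(2,3), of ?y] by simp
  then have "z *\<^sub>C A x = z *\<^sub>C B x" by (simp add: algebra_simps)
  then show ?thesis using A(4) by (simp add: complex_vector.scale_left_imp_eq)
qed

section \<open>Isometries, their ranges and adjoints\<close>

lemma isometric_operator_norm: "isometric_operator D A \<Longrightarrow> x \<in> D \<Longrightarrow> norm (A x) = norm x"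
  by (simp add: isometric_operator_def norm_sq_cinner flip: power2_eq_iff_nonneg[OF norm_ge_zero norm_ge_zero])

lemma isometry_contraction: "isometric_operator UNIV J \<Longrightarrow> contraction J"
  using isometric_operator_norm[of UNIV J] by (simp add: contraction_def isometric_operator_def)

lemma isometry_inj: "isometric_operator UNIV J \<Longrightarrow> inj J"
  using isometric_operator_norm[of UNIV J] contraction_diff[OF isometry_contraction[of J]]
  by (metis UNIV_I injI norm_eq_zero right_minus_eq)

lemma isometry_cinner: "isometric_operator UNIV J \<Longrightarrow> cinner (J x) (J y) = cinner x y"
  by (simp add: isometric_operator_def)

lemma subspace_range_isometry:
  assumes "isometric_operator UNIV J"
  shows "complex_vector.subspace (range J)"
proof -
  note c = isometry_contraction[OF assms]
  have "0 \<in> range J" using contraction_zero[OF c] by (metis rangeI)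
  moreover have "\<forall>x\<in>range J. \<forall>y\<in>range J. x + y \<in> range J"
    using contraction_add[OF c, symmetric] by simp
  moreover have "\<forall>a. \<forall>x\<in>range J. a *\<^sub>C x \<in> range J"
    using contraction_scaleC[OF c, symmetric] by simp
  ultimately show ?thesis unfolding complex_vector.subspace_def by blast
qed

lemma closed_range_isometry:
  assumes J: "isometric_operator UNIV J"
  shows "closed (range J)"
proof -
  note c = isometry_contraction[OF J]
  have "complete (J ` UNIV)"
  proof (rule complete_isometric_image[of 1])
    show "\<forall>x\<in>UNIV. norm (J x) \<ge> 1 * norm x" using isometric_operator_norm[OF J] by simp
    show "bounded_linear J" by (rule contraction_bounded_linear[OF c])
  qed (auto simp: complete_UNIV)
  then show ?thesis by (rule complete_imp_closed)
qed

text \<open>The Hilbert space adjoint \<open>J^*\<close>, written through the projection because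
  generalized resolvents are phrased that way; \<open>cinner_isometry_adjoint\<close> is the usual
  characterisation.\<close>

definition isometry_adjoint :: "('a::complex_hilbert_space \<Rightarrow> 'b::complex_hilbert_space) \<Rightarrow> 'b \<Rightarrow> 'a" where
  "isometry_adjoint J h = inv J (orthogonal_projection (range J) h)"

context
  fixes J :: "'a::complex_hilbert_space \<Rightarrow> 'b::complex_hilbert_space"
  assumes J: "isometric_operator UNIV J"
begin

lemma isometry_adjoint_projection: "J (isometry_adjoint J h) = orthogonal_projection (range J) h"
  unfolding isometry_adjoint_def
  using orthogonal_projection_in[OF subspace_range_isometry closed_range_isometry] J
  by (metis f_inv_into_f)

lemma cinner_isometry_adjoint: "cinner (isometry_adjoint J h) x = cinner h (J x)"
  using isometry_cinner[OF J, of "isometry_adjoint J h" x]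
  by (simp add: isometry_adjoint_projection cinner_orthogonal_projection subspace_range_isometry
      closed_range_isometry J)

lemma isometry_adjoint_isometry: "isometry_adjoint J (J x) = x"
  by (rule cinner_ext) (simp add: cinner_isometry_adjoint isometry_cinner[OF J])

lemma contraction_isometry_adjoint: "contraction (isometry_adjoint J)"
proof (rule contractionI)
  show "isometry_adjoint J (x + y) = isometry_adjoint J x + isometry_adjoint J y" for x y
    by (rule cinner_ext) (simp add: cinner_isometry_adjoint cinner_linear)
  show "isometry_adjoint J (a *\<^sub>C x) = a *\<^sub>C isometry_adjoint J x" for a x
    by (rule cinner_ext) (simp add: cinner_isometry_adjoint cinner_linear)
  show "norm (isometry_adjoint J x) \<le> norm x" for x
    using norm_orthogonal_projection_le(1)[OF subspace_range_isometry[OF J] closed_range_isometry[OF J], of x]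
      isometric_operator_norm[OF J, of "isometry_adjoint J x"]
    by (simp add: isometry_adjoint_projection)
qed

end

lemma unitary_contraction: "unitary_operator U \<Longrightarrow> contraction U"
  by (simp add: unitary_operator_def isometry_contraction)

text \<open>Since \<open>J\<close> is injective it can be cancelled, giving the compression
  \<open>J^* (1 - zU)^-1 J\<close>. For \<open>cmod z > 1\<close> the name \<open>resolvent\<close>
  still only abbreviates \<open>inv\<close> of the pencil.\<close>

lemma generalized_resolvent_for_iff:
  "generalized_resolvent_for J U D V R \<longleftrightarrow>
     isometric_operator UNIV J \<and> unitary_operator U \<and> (\<forall>x\<in>D. U (J x) = J (V x)) \<and>
     (\<forall>\<zeta> x. cmod \<zeta> \<noteq> 1 \<longrightarrow> R \<zeta> x = isometry_adjoint J (resolvent \<zeta> U (J x)))"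
  (is "_ \<longleftrightarrow> ?J \<and> ?U \<and> ?V \<and> ?R")
proof -
  have "?J \<Longrightarrow> (J a = orthogonal_projection (range J) h) = (a = isometry_adjoint J h)" for a h
    using isometry_adjoint_projection[of J h] isometry_inj[of J] by (metis injD)
  then show ?thesis unfolding generalized_resolvent_for_def resolvent_def by auto
qed

text \<open>Along a convergent sequence in \<open>D\<close> the images under \<open>V\<close> are
  Cauchy, so the pairs converge and the closed graph contains their limit.\<close>

lemma closed_isometric_domain:
  assumes V: "closed_operator D V" "isometric_operator D V"
  shows "closed D"
  unfolding closed_sequential_limits
proof (intro allI impI, elim conjE)
  fix x l assume x: "\<forall>n. x n \<in> D" and l: "x \<longlonglongrightarrow> l"
  have lin: "linear_operator D V" using V by (simp add: closed_operator_def)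
  then have D: "complex_vector.subspace D" by (simp add: linear_operator_def)
  have "norm (V (x n) - V (x m)) = norm (x n - x m)" for n m
    using x isometric_operator_norm[OF V(2), of "x n - x m"] complex_vector.subspace_diff[OF D]
    by (simp add: linear_operator_diff[OF lin])
  then have "Cauchy (\<lambda>n. V (x n))"
    using LIMSEQ_imp_Cauchy[OF l] by (simp add: Cauchy_iff)
  then obtain y where y: "(\<lambda>n. V (x n)) \<longlonglongrightarrow> y" by (auto simp: Cauchy_convergent_iff convergent_def)
  have "(l, y) \<in> {(x, V x) | x. x \<in> D}"
  proof (rule closed_sequentially)
    show "closed {(x, V x) | x. x \<in> D}" using V by (simp add: closed_operator_def)
    show "(\<lambda>n. (x n, V (x n))) \<longlonglongrightarrow> (l, y)" by (intro tendsto_Pair l y)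
  qed (use x in auto)
  then show "l \<in> D" by auto
qed

section \<open>The characteristic function of a unitary extension\<close>

text \<open>Relative to \<open>range J\<close> and its complement write \<open>U\<close> as a block matrix with rows
  \<open>(A, B)\<close> and \<open>(C, E)\<close>; this is the transfer function \<open>A + z B (1 - z E)\<^sup>-\<^sup>1 C\<close>.\<close>

definition lower_part :: "('a::complex_hilbert_space \<Rightarrow> 'b::complex_hilbert_space) \<Rightarrow> ('b \<Rightarrow> 'b) \<Rightarrow> 'b \<Rightarrow> 'b" where
  "lower_part J U h = U h - J (isometry_adjoint J (U h))"

definition characteristic_function ::
  "('a::complex_hilbert_space \<Rightarrow> 'b::complex_hilbert_space) \<Rightarrow> ('b \<Rightarrow> 'b) \<Rightarrow> complex \<Rightarrow> 'a \<Rightarrow> 'a" where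
  "characteristic_function J U z x = isometry_adjoint J (U (resolvent z (lower_part J U) (J x)))"

context
  fixes J :: "'a::complex_hilbert_space \<Rightarrow> 'b::complex_hilbert_space" and U :: "'b \<Rightarrow> 'b"
  assumes J: "isometric_operator UNIV J" and U: "unitary_operator U"
begin

private lemma cJ: "contraction J" by (rule isometry_contraction[OF J])
private lemma cA: "contraction (isometry_adjoint J)" by (rule contraction_isometry_adjoint[OF J])
private lemma cU: "contraction U" by (rule unitary_contraction[OF U])
private lemma iU: "isometric_operator UNIV U" using U by (simp add: unitary_operator_def)

lemma contraction_lower_part: "contraction (lower_part J U)"
proof (rule contractionI)
  show "norm (lower_part J U x) \<le> norm x" for x
  proof -
    have "norm (lower_part J U x) \<le> norm (U x)"
      unfolding lower_part_def isometry_adjoint_projection[OF J]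
      by (rule norm_orthogonal_projection_le(2)[OF subspace_range_isometry[OF J] closed_range_isometry[OF J]])
    then show ?thesis using contraction_norm[OF cU, of x] by simp
  qed
qed (simp_all add: lower_part_def contraction_linear[OF cJ] contraction_linear[OF cU]
    contraction_linear[OF cA] scaleC_linear)

lemma cinner_lower_part: "cinner (lower_part J U x) (J y) = 0"
  by (simp add: lower_part_def cinner_linear isometry_cinner[OF J] cinner_isometry_adjoint[OF J])

text \<open>An energy balance. Both \<open>u = J x + z T\<close> and \<open>U u = J W + T\<close>
  are orthogonal decompositions with the same \<open>T\<close>, and \<open>U\<close> preserves
  norms, so \<open>|W|^2 = |x|^2 - (1 - |z|^2) |T|^2\<close>.\<close>

lemma contraction_characteristic_function:
  assumes z: "cmod z < 1"
  shows "contraction (characteristic_function J U z)"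
proof (rule contractionI)
  fix x
  define u where "u = resolvent z (lower_part J U) (J x)"
  let ?T = "lower_part J U u" and ?W = "isometry_adjoint J (U u)"
  have u: "u = J x + z *\<^sub>C ?T"
    unfolding u_def by (rule resolvent_eq[OF contraction_lower_part z])
  have "cinner (J x) ?T = 0" using cinner_commute[of "J x" ?T] by (simp add: cinner_lower_part)
  then have 1: "(norm u)\<^sup>2 = (norm x)\<^sup>2 + (cmod z)\<^sup>2 * (norm ?T)\<^sup>2"
    by (subst u) (simp add: norm_add_sq cinner_linear isometric_operator_norm[OF J] power_mult_distrib)
  have "cinner (J ?W) ?T = 0" using cinner_commute[of "J ?W" ?T] by (simp add: cinner_lower_part)
  moreover have "U u = J ?W + ?T" by (simp add: lower_part_def)
  ultimately have "(norm (U u))\<^sup>2 = (norm ?W)\<^sup>2 + (norm ?T)\<^sup>2"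
    using norm_add_sq[of "J ?W" ?T] by (simp add: isometric_operator_norm[OF J])
  then have 2: "(norm u)\<^sup>2 = (norm ?W)\<^sup>2 + (norm ?T)\<^sup>2" by (simp add: isometric_operator_norm[OF iU])
  have "(cmod z)\<^sup>2 * (norm ?T)\<^sup>2 \<le> 1 * (norm ?T)\<^sup>2"
    using z by (intro mult_right_mono) (auto simp: power_le_one)
  then have "(norm ?W)\<^sup>2 \<le> (norm x)\<^sup>2" using 1 2 by linarith
  then show "norm (characteristic_function J U z x) \<le> norm x"
    unfolding characteristic_function_def u_def by (rule power2_le_imp_le) simp
qed (simp_all add: characteristic_function_def contraction_linear[OF cJ] contraction_linear[OF cU]
    contraction_linear[OF cA] resolvent_add[OF contraction_lower_part z]
    resolvent_scaleC[OF contraction_lower_part z])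

text \<open>Let \<open>v\<close> be the resolvent of \<open>U\<close> at \<open>J x\<close> and
  \<open>r = J^* v\<close>. Splitting \<open>v = J x + z U v\<close> along the range of
  \<open>J\<close>, the complementary part shows that \<open>v\<close> is the resolvent of
  \<open>lower_part\<close> at \<open>J r\<close>; the part in the range then becomes
  \<open>r = x + z W r\<close>.\<close>

lemma compressed_resolvent:
  assumes z: "cmod z < 1"
  shows "isometry_adjoint J (resolvent z U (J x)) = resolvent z (characteristic_function J U z) x"
proof (rule resolvent_eqI[OF contraction_characteristic_function[OF z] z, symmetric])
  define v where "v = resolvent z U (J x)"
  let ?r = "isometry_adjoint J v"
  have v: "v = J x + z *\<^sub>C U v" unfolding v_def by (rule resolvent_eq[OF cU z])
  have r: "?r = x + z *\<^sub>C isometry_adjoint J (U v)"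
    by (subst v) (simp add: contraction_linear[OF cA] isometry_adjoint_isometry[OF J])
  have "v = J ?r + z *\<^sub>C lower_part J U v"
    unfolding lower_part_def
    by (subst r, subst v) (simp add: contraction_linear[OF cJ] scaleC_linear)
  then have "resolvent z (lower_part J U) (J ?r) = v"
    by (rule resolvent_eqI[OF contraction_lower_part z])
  then have "isometry_adjoint J (U v) = characteristic_function J U z ?r"
    by (simp add: characteristic_function_def)
  then show "?r = x + z *\<^sub>C characteristic_function J U z ?r" using r by simp
qed

text \<open>As \<open>U\<close> sends \<open>J x\<close> into the range of \<open>J\<close>, nothing
  feeds back through the complement.\<close>

lemma characteristic_function_domain:
  assumes z: "cmod z < 1" and x: "U (J x) = J y"
  shows "characteristic_function J U z x = y"
proof -
  have "lower_part J U (J x) = 0" by (simp add: lower_part_def x isometry_adjoint_isometry[OF J])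
  then have "resolvent z (lower_part J U) (J x) = J x"
    by (intro resolvent_eqI[OF contraction_lower_part z]) simp
  then show ?thesis by (simp add: characteristic_function_def x isometry_adjoint_isometry[OF J])
qed

text \<open>With \<open>y\<close> in \<open>D\<close> and \<open>y' = V y\<close> this shows that
  vectors orthogonal to \<open>D\<close> go to vectors orthogonal to the range of \<open>V\<close>.
  The isometry \<open>U\<close> is moved off both arguments, and \<open>?u\<close> differs from
  \<open>J x\<close> only by a vector orthogonal to the range of \<open>J\<close>.\<close>

lemma cinner_characteristic_function:
  assumes z: "cmod z < 1" and y: "U (J y) = J y'"
  shows "cinner (characteristic_function J U z x) y' = cinner x y"
proof -
  let ?u = "resolvent z (lower_part J U) (J x)"
  have "cinner (characteristic_function J U z x) y' = cinner ?u (J y)"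
    by (simp add: characteristic_function_def cinner_isometry_adjoint[OF J] y[symmetric]
        isometry_cinner[OF iU])
  also have "\<dots> = cinner x y"
    by (subst resolvent_eq[OF contraction_lower_part z])
       (simp add: cinner_linear cinner_lower_part isometry_cinner[OF J])
  finally show ?thesis .
qed

lemma characteristic_function_analytic:
  assumes N: "complex_vector.subspace N" "closed N'"  "complex_vector.subspace N'"
    and im: "\<And>z. cmod z < 1 \<Longrightarrow> characteristic_function J U z ` N \<subseteq> N'"
  shows "operator_analytic_on (characteristic_function J U) (ball 0 1) N N'"
  unfolding operator_analytic_on_def
proof
  fix z :: complex assume "z \<in> ball 0 1"
  then have z: "cmod z < 1" by simp
  let ?T = "lower_part J U"
  let ?S = "\<lambda>w. resolvent w ?T"
  define B where "B = (\<lambda>h. isometry_adjoint J (U h))"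
  have cB: "contraction B" unfolding B_def by (rule contraction_comp[OF cA cU])
  note T = contraction_lower_part
  \<comment> \<open>The derivative of \<open>(1 - wT)^-1\<close> at \<open>z\<close> is
    \<open>(1 - zT)^-1 T (1 - zT)^-1\<close>. The error of the difference quotient is again a
    difference of resolvents, so the identity \<open>diff\<close> is used twice.\<close>
  define G where "G x = B (?S z (?T (?S z (J x))))" for x
  have diff: "?S w y - ?S z y = (w - z) *\<^sub>C ?S w (?T (?S z y))" if w: "cmod w < 1" for w y
    using resolvent_difference[OF T w T z, of y] resolvent_scaleC[OF T w]
    by (simp flip: complex_vector.scale_left_diff_distrib)
  have W: "characteristic_function J U w x = B (?S w (J x))" for w x
    by (simp add: characteristic_function_def B_def)
  have lin: "linear_operator N G"
    unfolding linear_operator_def G_def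
    using N by (simp add: contraction_linear[OF cJ] contraction_linear[OF cB] contraction_linear[OF T]
        resolvent_add[OF T z] resolvent_scaleC[OF T z])
  define d where "d = 1 - cmod z"
  have d: "d > 0" using z by (simp add: d_def)
  have S: "norm (?S z y) \<le> norm y / d" for y unfolding d_def by (rule norm_resolvent_le[OF T z])
  have ST: "norm (?S z (?T y)) \<le> norm y / d" for y
    using S[of "?T y"] contraction_norm[OF T, of y] d by (meson divide_right_mono less_imp_le order_trans)
  have STS: "norm (?S z (?T (?S z (J x)))) \<le> norm x / d / d" for x
    using ST[of "?S z (J x)"] S[of "J x"] d contraction_norm[OF cJ, of x]
    by (meson divide_right_mono less_imp_le order_trans)
  have lim: "\<forall>\<^sub>F w in at z. \<forall>x. norm (inverse (w - z) *\<^sub>C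
      (characteristic_function J U w x - characteristic_function J U z x) - G x) \<le> e * norm x"
    if e: "e > 0" for e
  proof -
    have "isCont (\<lambda>w. cmod (w - z)) z" by (intro continuous_intros)
    then have "(\<lambda>w. cmod (w - z)) \<midarrow>z\<rightarrow> 0" by (simp add: isCont_def)
    \<comment> \<open>The bound \<open>d/2\<close> keeps \<open>1 - cmod w\<close> above
      \<open>d/2\<close>; the other bound cancels the three resolvent estimates \<open>1/d\<close>,
      \<open>1/d\<close> and \<open>2/d\<close>, leaving exactly \<open>e\<close>.\<close>
    then have "\<forall>\<^sub>F w in at z. cmod (w - z) < min (d/2) (e * d * d * d / 2)"
      using e d by (intro order_tendstoD) auto
    moreover have "\<forall>\<^sub>F w in at z. w \<noteq> z" by (simp add: eventually_at_filter)
    ultimately show ?thesis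
    proof eventually_elim
      case (elim w)
      have "cmod w \<le> cmod z + cmod (w - z)" using norm_triangle_ineq[of z "w - z"] by simp
      then have wd: "1 - cmod w > d/2" using elim by (auto simp: d_def)
      then have w: "cmod w < 1" using d by simp
      show ?case
      proof
        fix x
        let ?y = "?T (?S z (J x))"
        have "inverse (w - z) *\<^sub>C (characteristic_function J U w x - characteristic_function J U z x) - G x
          = inverse (w - z) *\<^sub>C B (?S w (J x) - ?S z (J x)) - G x"
          by (simp add: W contraction_linear[OF cB])
        also have "\<dots> = B (?S w ?y) - G x"
          unfolding diff[OF w] contraction_scaleC[OF cB] scaleC_scaleC
          using elim by (simp add: scaleC_one)
        also have "\<dots> = B (?S w ?y - ?S z ?y)" by (simp add: G_def contraction_linear[OF cB])
        finally have "norm (inverse (w - z) *\<^sub>C (characteristic_function J U w x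
            - characteristic_function J U z x) - G x) \<le> norm (?S w ?y - ?S z ?y)"
          by (simp add: contraction_norm[OF cB])
        moreover have "norm (?S w ?y - ?S z ?y) = cmod (w - z) * norm (?S w (?T (?S z ?y)))"
          by (simp add: diff[OF w])
        moreover have "norm (?S w (?T (?S z ?y))) \<le> (norm x / d / d) / (d/2)"
        proof -
          have "norm (?S w (?T (?S z ?y))) \<le> norm (?T (?S z ?y)) / (1 - cmod w)"
            by (rule norm_resolvent_le[OF T w])
          also have "\<dots> \<le> (norm x / d / d) / (d/2)"
            using wd d STS[of x] contraction_norm[OF T, of "?S z ?y"] by (intro frac_le) auto
          finally show ?thesis .
        qed
        then have "cmod (w - z) * norm (?S w (?T (?S z ?y)))
            \<le> (e * d * d * d / 2) * ((norm x / d / d) / (d/2))"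
          using elim d e by (intro mult_mono) auto
        moreover have "(e * d * d * d / 2) * ((norm x / d / d) / (d/2)) = e * norm x" using d by simp
        ultimately show "norm (inverse (w - z) *\<^sub>C (characteristic_function J U w x
            - characteristic_function J U z x) - G x) \<le> e * norm x"
          by linarith
      qed
    qed
  qed
  \<comment> \<open>The difference quotients take values in the closed subspace \<open>N'\<close>,
    hence so does their limit.\<close>
  have "G x \<in> N'" if x: "x \<in> N" for x
  proof (rule Lim_in_closed_set[OF N(2)])
    let ?q = "\<lambda>w. inverse (w - z) *\<^sub>C (characteristic_function J U w x - characteristic_function J U z x)"
    have "\<forall>\<^sub>F w in at z. w \<in> ball 0 1" using z by (intro eventually_at_in_open') auto
    then show "\<forall>\<^sub>F w in at z. ?q w \<in> N'"
      by eventually_elim (use im z x N in \<open>auto intro!: complex_vector.subspace_scale complex_vector.subspace_diff\<close>)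
    show "(?q \<longlongrightarrow> G x) (at z)"
    proof (rule tendsto_of_norm_bound)
      fix e :: real assume "e > 0"
      from lim[OF this] show "\<forall>\<^sub>F w in at z. norm (?q w - G x) \<le> e * norm x"
        by (rule eventually_mono) blast
    qed simp
  qed simp
  then have "G ` N \<subseteq> N'" by blast
  moreover have "\<forall>x\<in>N. norm (G x) \<le> (1 / d / d) * norm x"
    unfolding G_def using order_trans[OF contraction_norm[OF cB] STS] by simp
  moreover have "\<forall>\<^sub>F w in at z. \<forall>x\<in>N. norm (inverse (w - z) *\<^sub>C
      (characteristic_function J U w x - characteristic_function J U z x) - G x) \<le> e * norm x"
    if "e > 0" for e
    using lim[OF that] by (rule eventually_mono) blast
  ultimately show "\<exists>G. linear_operator N G \<and> G ` N \<subseteq> N' \<and> (\<exists>C. \<forall>x\<in>N. norm (G x) \<le> C * norm x) \<and>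
        (\<forall>e>0. \<forall>\<^sub>F w in at z. \<forall>x\<in>N. norm (inverse (w - z) *\<^sub>C (characteristic_function J U w x
          - characteristic_function J U z x) - G x) \<le> e * norm x)"
    by (intro exI[of _ G] conjI exI[of _ "1 / d / d"] allI impI) (rule lin | assumption)+
qed

end

section \<open>Direct sums of an isometry and a contraction\<close>

text \<open>The values of \<open>V\<close> and of \<open>F\<close> are orthogonal, as are the two
  components of the argument, so Pythagoras applies on both sides.\<close>

lemma direct_sum_contraction:
  assumes D: "complex_vector.subspace D" "closed D" and V: "isometric_operator D V"
    and F: "linear_operator (defect_zero D) F" "F ` defect_zero D \<subseteq> defect_infinity D V"
      "\<And>x. x \<in> defect_zero D \<Longrightarrow> norm (F x) \<le> norm x"
  shows "contraction (direct_sum_operator D V F)"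
proof -
  define p where "p = orthogonal_projection D"
  define q where "q = orthogonal_projection (orthogonal_complement D)"
  have p: "p (x + y) = p x + p y" "p (a *\<^sub>C x) = a *\<^sub>C p x" "p x \<in> D" for x y a
    using orthogonal_projection_linear[OF D] orthogonal_projection_in[OF D]
    by (auto simp: p_def linear_operator_UNIV)
  note Dp = subspace_orthogonal_complement[of D] closed_orthogonal_complement[of D]
  have q: "q (x + y) = q x + q y" "q (a *\<^sub>C x) = a *\<^sub>C q x" "q x \<in> defect_zero D" for x y a
    using orthogonal_projection_linear[OF Dp] orthogonal_projection_in[OF Dp]
    by (auto simp: q_def linear_operator_UNIV defect_zero_def)
  have Vl: "V (x + y) = V x + V y" "V (a *\<^sub>C x) = a *\<^sub>C V x" if "x \<in> D" "y \<in> D" for x y a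
    using V that by (auto simp: isometric_operator_def linear_operator_def)
  have Fl: "F (x + y) = F x + F y" "F (a *\<^sub>C x) = a *\<^sub>C F x"
    if "x \<in> defect_zero D" "y \<in> defect_zero D" for x y a
    using F(1) that by (auto simp: linear_operator_def)
  have T: "direct_sum_operator D V F x = V (p x) + F (q x)" for x
    by (simp add: direct_sum_operator_def p_def q_def)
  show ?thesis
  proof (rule contractionI)
    fix x y :: 'a and a :: complex
    show "direct_sum_operator D V F (x + y) = direct_sum_operator D V F x + direct_sum_operator D V F y"
      by (simp add: T p q Vl Fl)
    show "direct_sum_operator D V F (a *\<^sub>C x) = a *\<^sub>C direct_sum_operator D V F x"
      by (simp add: T p(2) q(2) Vl(2)[OF p(3) p(3)] Fl(2)[OF q(3) q(3)] scaleC_add_right)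
    have "F (q x) \<in> orthogonal_complement (V ` D)"
      using F(2) q(3) by (auto simp: defect_infinity_def)
    then have "cinner (F (q x)) (V (p x)) = 0" using p(3) by (simp add: orthogonal_complement_def)
    then have "(norm (direct_sum_operator D V F x))\<^sup>2 = (norm (F (q x)))\<^sup>2 + (norm (V (p x)))\<^sup>2"
      using norm_add_sq[of "F (q x)" "V (p x)"] by (simp add: T add.commute)
    also have "\<dots> \<le> (norm (q x))\<^sup>2 + (norm (p x))\<^sup>2"
      using F(3)[OF q(3)] isometric_operator_norm[OF V p(3)] by (simp add: power_mono)
    also have "\<dots> = (norm x)\<^sup>2"
      using norm_orthogonal_split[OF D, of x] orthogonal_projection_complement[OF D, of x]
      by (simp add: p_def q_def)
    finally show "norm (direct_sum_operator D V F x) \<le> norm x" by (rule power2_le_imp_le) simp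
  qed
qed

lemma direct_sum_operator_domain:
  assumes D: "complex_vector.subspace D" "closed D" and "F 0 = 0" "x \<in> D"
  shows "direct_sum_operator D V F x = V x"
  using assms by (simp add: direct_sum_operator_def orthogonal_projection_complement[OF D]
      orthogonal_projection_ident[OF D])

lemma direct_sum_operator_defect:
  assumes D: "complex_vector.subspace D" "closed D" and "V 0 = 0" "x \<in> defect_zero D"
  shows "direct_sum_operator D V F x = F x"
proof -
  have "orthogonal_projection D x = 0"
    using assms cinner_commute by (intro orthogonal_projection_eqI[OF D] complex_vector.subspace_0)
      (auto simp: defect_zero_def orthogonal_complement_def)
  then show ?thesis using assms
    by (simp add: direct_sum_operator_def orthogonal_projection_complement[OF D])
qed

section \<open>Vectors with a prescribed Gram matrix\<close>

text \<open>Hermitian symmetry makes the double sum real, so \<open>Re\<close> loses nothing. The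
  place of the conjugate matches Gram matrices \<open>k s t = cinner (v s) (v t)\<close>.\<close>

definition positive_kernel :: "('i \<Rightarrow> 'i \<Rightarrow> complex) \<Rightarrow> bool" where
  "positive_kernel k \<longleftrightarrow> (\<forall>s t. k t s = cnj (k s t)) \<and>
     (\<forall>S c. finite S \<longrightarrow> 0 \<le> Re (\<Sum>s\<in>S. \<Sum>t\<in>S. c s * cnj (c t) * k s t))"

lemma positive_kernel_hermitian: "positive_kernel k \<Longrightarrow> k t s = cnj (k s t)"
  and positive_kernel_sum:
    "positive_kernel k \<Longrightarrow> finite S \<Longrightarrow> 0 \<le> Re (\<Sum>s\<in>S. \<Sum>t\<in>S. c s * cnj (c t) * k s t)"
  unfolding positive_kernel_def by blast+

lemma positive_kernel_diagonal:
  assumes "positive_kernel k"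
  shows "k n n = complex_of_real (Re (k n n))" "Re (k n n) \<ge> 0"
proof -
  have "Im (k n n) = - Im (k n n)"
    using arg_cong[OF positive_kernel_hermitian[OF assms, of n n], of Im] by simp
  then show "k n n = complex_of_real (Re (k n n))" by (simp add: complex_eq_iff)
  show "Re (k n n) \<ge> 0" using positive_kernel_sum[OF assms, of "{n}" "\<lambda>_. 1"] by simp
qed

text \<open>Testing with coefficient 1 at \<open>s\<close> and \<open>- r * k s n\<close> at
  \<open>n\<close> makes the form affine in the real number \<open>r\<close>, so its slope has to
  vanish.\<close>

lemma positive_kernel_null:
  assumes k: "positive_kernel k" and n: "k n n = 0"
  shows "k s n = 0"
proof (cases "s = n")
  case False
  have herm: "k n s = cnj (k s n)" by (rule positive_kernel_hermitian[OF k])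
  have *: "2 * r * (cmod (k s n))\<^sup>2 \<le> Re (k s s)" for r
  proof -
    define c where "c i = (if i = s then 1 else - complex_of_real r * k s n)" for i
    have "0 \<le> Re (\<Sum>i\<in>{s, n}. \<Sum>j\<in>{s, n}. c i * cnj (c j) * k i j)"
      by (rule positive_kernel_sum[OF k]) simp
    also have "(\<Sum>i\<in>{s, n}. \<Sum>j\<in>{s, n}. c i * cnj (c j) * k i j)
        = k s s - 2 * complex_of_real r * (k s n * cnj (k s n))"
      using False n by (simp add: c_def herm algebra_simps)
    also have "\<dots> = k s s - complex_of_real (2 * r * (cmod (k s n))\<^sup>2)"
      by (simp add: complex_norm_square[symmetric])
    finally show ?thesis by simp
  qed
  show ?thesis
  proof (rule ccontr)
    assume "k s n \<noteq> 0"
    then show False using *[of "(Re (k s s) + 1) / (2 * (cmod (k s n))\<^sup>2)"] by simp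
  qed
qed (use n in simp)

text \<open>If \<open>k n n = 0\<close> then division by zero makes this the identity, as it should be.\<close>

definition schur_complement :: "('i \<Rightarrow> 'i \<Rightarrow> complex) \<Rightarrow> 'i \<Rightarrow> 'i \<Rightarrow> 'i \<Rightarrow> complex" where
  "schur_complement k n s t = k s t - k s n * cnj (k t n) / k n n"

text \<open>Completing the square: minimising the form of \<open>k\<close> over an extra coefficient
  at \<open>n\<close> leaves the form of the Schur complement. As \<open>n\<close> may or may not
  lie in \<open>S\<close>, the sums run over \<open>insert n S\<close> with \<open>c\<close>
  extended by 0.\<close>

lemma positive_kernel_schur_complement:
  assumes k: "positive_kernel k"
  shows "positive_kernel (schur_complement k n)"
  unfolding positive_kernel_def
proof (intro conjI allI impI)
  note herm = positive_kernel_hermitian[OF k]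
  define r where "r = Re (k n n)"
  have knn: "k n n = complex_of_real r" using positive_kernel_diagonal[OF k] by (simp add: r_def)
  show "schur_complement k n t s = cnj (schur_complement k n s t)" for s t
    using herm[of s t] by (simp add: schur_complement_def knn)
  fix S :: "'a set" and c
  assume S: "finite S"
  define b where "b = (\<Sum>s\<in>S. c s * k s n)"
  define x where "x s = (if s \<in> S then c s else 0)" for s
  \<comment> \<open>The minimising extra coefficient at \<open>n\<close>.\<close>
  define l where "l = - b / k n n"
  define y where "y s = (if s = n then l else 0)" for s
  let ?S = "insert n S"
  have fin: "finite ?S" using S by simp
  have sub: "S \<subseteq> ?S" by auto
  have Q: "(\<Sum>s\<in>?S. \<Sum>t\<in>?S. x s * cnj (x t) * k s t) = (\<Sum>s\<in>S. \<Sum>t\<in>S. c s * cnj (c t) * k s t)"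
    by (intro sum.mono_neutral_cong_right fin sub) (auto intro!: sum.mono_neutral_cong_right fin sum.neutral simp: x_def)
  have b1: "(\<Sum>s\<in>?S. x s * k s n) = b"
    unfolding b_def by (intro sum.mono_neutral_cong_right fin sub) (auto simp: x_def)
  have b2: "(\<Sum>t\<in>?S. cnj (x t) * k n t) = cnj b"
    unfolding b1[symmetric] cnj_sum complex_cnj_mult by (simp only: herm[symmetric])
  have yl: "(\<Sum>t\<in>?S. cnj (y t) * f t) = cnj l * f n" "(\<Sum>t\<in>?S. y t * f t) = l * f n" for f
    using fin by (simp_all add: y_def if_distrib[of cnj] if_distrib[of "\<lambda>x. x * _"] cong: if_cong)
  have "(\<Sum>s\<in>?S. \<Sum>t\<in>?S. (x s + y s) * cnj (x t + y t) * k s t)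
    = (\<Sum>s\<in>?S. \<Sum>t\<in>?S. x s * cnj (x t) * k s t) + (\<Sum>s\<in>?S. x s * (\<Sum>t\<in>?S. cnj (y t) * k s t))
      + (\<Sum>s\<in>?S. y s * (\<Sum>t\<in>?S. cnj (x t) * k s t)) + (\<Sum>s\<in>?S. y s * (\<Sum>t\<in>?S. cnj (y t) * k s t))"
    unfolding sum_distrib_left sum.distrib[symmetric]
    by (intro sum.cong refl) (simp add: algebra_simps)
  also have "\<dots> = (\<Sum>s\<in>S. \<Sum>t\<in>S. c s * cnj (c t) * k s t) + cnj l * b + l * cnj b + l * cnj l * k n n"
  proof -
    have "(\<Sum>s\<in>?S. x s * (\<Sum>t\<in>?S. cnj (y t) * k s t)) = cnj l * (\<Sum>s\<in>?S. x s * k s n)"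
      unfolding yl sum_distrib_left by (simp only: mult.left_commute)
    then show ?thesis unfolding yl Q b1 b2 by simp
  qed
  \<comment> \<open>For \<open>r = 0\<close> both \<open>l\<close> and the subtracted quotient are
    0, by the convention on division.\<close>
  also have "\<dots> = (\<Sum>s\<in>S. \<Sum>t\<in>S. c s * cnj (c t) * k s t) - b * cnj b / k n n"
    by (cases "r = 0") (simp_all add: l_def knn field_simps)
  also have "b * cnj b / k n n = (\<Sum>s\<in>S. \<Sum>t\<in>S. c s * cnj (c t) * (k s n * cnj (k t n) / k n n))"
    unfolding b_def cnj_sum sum_product sum_divide_distrib
    by (intro sum.cong refl) (simp add: mult_ac)
  also have "(\<Sum>s\<in>S. \<Sum>t\<in>S. c s * cnj (c t) * k s t) - \<dots>
    = (\<Sum>s\<in>S. \<Sum>t\<in>S. c s * cnj (c t) * schur_complement k n s t)"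
    unfolding schur_complement_def right_diff_distrib sum_subtractf ..
  finally show "0 \<le> Re (\<Sum>s\<in>S. \<Sum>t\<in>S. c s * cnj (c t) * schur_complement k n s t)"
    using positive_kernel_sum[OF k fin, of "\<lambda>s. x s + y s"] by simp
qed

primrec iterated_schur_complement :: "(nat \<Rightarrow> nat \<Rightarrow> complex) \<Rightarrow> nat \<Rightarrow> nat \<Rightarrow> nat \<Rightarrow> complex" where
  "iterated_schur_complement k 0 = k"
| "iterated_schur_complement k (Suc n) = schur_complement (iterated_schur_complement k n) n"

lemma positive_kernel_iterated:
  "positive_kernel k \<Longrightarrow> positive_kernel (iterated_schur_complement k n)"
  by (induction n) (auto intro: positive_kernel_schur_complement)

text \<open>Step \<open>n\<close> clears row and column \<open>n\<close>, and cleared ones stay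
  cleared because the correction contains a zero factor. If the pivot is 0, positivity has already
  forced its row and column to vanish.\<close>

lemma iterated_schur_complement_eq_0:
  assumes k: "positive_kernel k" and "i < m"
  shows "iterated_schur_complement k m s i = 0" "iterated_schur_complement k m i s = 0"
proof -
  note herm = positive_kernel_hermitian[OF positive_kernel_iterated[OF k]]
  have "iterated_schur_complement k m s i = 0" using \<open>i < m\<close>
  proof (induction m arbitrary: s)
    case (Suc m)
    let ?k = "iterated_schur_complement k m"
    have K: "positive_kernel ?k" by (rule positive_kernel_iterated[OF k])
    show ?case
    proof (cases "i = m")
      case True
      have "cnj (?k m m) = ?k m m" using positive_kernel_diagonal(1)[OF K, of m]
        by (metis complex_cnj_complex_of_real)
      then show ?thesis using positive_kernel_null[OF K, of m s] True
        by (cases "?k m m = 0") (simp_all add: schur_complement_def)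
    next
      case False
      then have "?k t i = 0" for t using Suc by simp
      then show ?thesis using herm[where n1 = m and s = i and t = m] by (simp add: schur_complement_def)
    qed
  qed simp
  then show "iterated_schur_complement k m s i = 0" "iterated_schur_complement k m i s = 0"
    using herm[where n1 = m and s = s and t = i] by simp_all
qed

text \<open>The Cholesky factorisation: the vectors are the rows of a lower triangular matrix.\<close>

lemma gram_vectors_nat:
  assumes k: "positive_kernel (k :: nat \<Rightarrow> nat \<Rightarrow> complex)"
  shows "\<exists>v :: nat \<Rightarrow> ell2. \<forall>s t. cinner (v s) (v t) = k s t"
proof -
  let ?k = "iterated_schur_complement k"
  \<comment> \<open>Column \<open>n\<close> of the Cholesky factor. A zero pivot gives a zero
    column, in agreement with the elimination step, which then changes nothing.\<close>
  define v where "v s n = ?k n s n / complex_of_real (sqrt (Re (?k n n n)))" for s n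
  note K = positive_kernel_iterated[OF k]
  have vv: "v s n * cnj (v t n) = ?k n s n * cnj (?k n t n) / ?k n n n" for s t n
  proof -
    have "complex_of_real (sqrt (Re (?k n n n))) * complex_of_real (sqrt (Re (?k n n n))) = ?k n n n"
      using positive_kernel_diagonal[OF K, of n n] by (simp flip: of_real_mult)
    then show ?thesis unfolding v_def by (simp flip: times_divide_times_eq)
  qed
  have split: "k s t = ?k m s t + (\<Sum>n<m. v s n * cnj (v t n))" for s t m
    by (induction m) (simp_all add: vv schur_complement_def)
  have v0: "v s n = 0" if "s < n" for s n
    using iterated_schur_complement_eq_0(2)[OF k that] by (simp add: v_def)
  have "summable (\<lambda>n. (cmod (v s n))\<^sup>2)" for s
    by (rule summable_finite[of "{..s}"]) (auto simp: v0)
  then have nth: "ell2_nth (Abs_ell2 (v s)) = v s" for s by (simp add: Abs_ell2_inverse)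
  have "cinner (Abs_ell2 (v s)) (Abs_ell2 (v t)) = k s t" for s t
  proof -
    \<comment> \<open>Row \<open>t\<close> ends at index \<open>t\<close>, and after
      \<open>Suc t\<close> elimination steps the remainder in column \<open>t\<close> is 0, so the
      truncated sum is exact.\<close>
    have "(\<Sum>n. v s n * cnj (v t n)) = (\<Sum>n<Suc t. v s n * cnj (v t n))"
      by (rule suminf_finite) (auto simp: v0)
    also have "\<dots> = k s t"
      using split[of s t "Suc t"] iterated_schur_complement_eq_0(1)[OF k, of t "Suc t" s] by simp
    finally show ?thesis by (simp add: cinner_ell2.rep_eq nth)
  qed
  then show ?thesis by (intro exI[of _ "\<lambda>s. Abs_ell2 (v s)"]) simp
qed

lemma positive_kernel_pullback:
  assumes "positive_kernel k" "inj f"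
  shows "positive_kernel (\<lambda>s t. k (f s) (f t))"
  unfolding positive_kernel_def
proof (intro conjI allI impI)
  fix S :: "'b set" and c :: "'b \<Rightarrow> complex" assume S: "finite S"
  have "0 \<le> Re (\<Sum>s\<in>f ` S. \<Sum>t\<in>f ` S. c (inv f s) * cnj (c (inv f t)) * k s t)"
    using S by (intro positive_kernel_sum[OF assms(1)]) simp
  then show "0 \<le> Re (\<Sum>s\<in>S. \<Sum>t\<in>S. c s * cnj (c t) * k (f s) (f t))"
    using assms(2) by (simp add: sum.reindex inj_on_subset[OF assms(2)])
qed (rule positive_kernel_hermitian[OF assms(1)])

section \<open>Isometries between closed spans\<close>

lemma subspace_closure:
  fixes S :: "'a::complex_hilbert_space set"
  assumes S: "complex_vector.subspace S"
  shows "complex_vector.subspace (closure S)"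
  unfolding complex_vector.subspace_def
proof (intro conjI ballI allI)
  show "0 \<in> closure S" using complex_vector.subspace_0[OF S] closure_subset by blast
next
  fix x y assume "x \<in> closure S" "y \<in> closure S"
  then obtain f g where "\<forall>n. f n \<in> S" "f \<longlonglongrightarrow> x" "\<forall>n. g n \<in> S" "g \<longlonglongrightarrow> y"
    unfolding closure_sequential by blast
  then show "x + y \<in> closure S" unfolding closure_sequential
    by (intro exI[of _ "\<lambda>n. f n + g n"]) (auto intro: tendsto_add complex_vector.subspace_add[OF S])
next
  fix a x assume "x \<in> closure S"
  then obtain f where "\<forall>n. f n \<in> S" "f \<longlonglongrightarrow> x" unfolding closure_sequential by blast
  then show "a *\<^sub>C x \<in> closure S" unfolding closure_sequential
    by (intro exI[of _ "\<lambda>n. a *\<^sub>C f n"])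
       (auto intro: tendsto_scaleC complex_vector.subspace_scale[OF S])
qed

text \<open>Linearity comes for free: the defect of additivity or homogeneity has inner product 0
  with itself, since all inner products can be computed on the side of the arguments.\<close>

lemma cinner_preserving_linear:
  fixes f :: "'a::complex_hilbert_space \<Rightarrow> 'b::complex_hilbert_space"
  assumes M: "complex_vector.subspace M"
    and f: "\<And>x y. x \<in> M \<Longrightarrow> y \<in> M \<Longrightarrow> cinner (f x) (f y) = cinner x y"
  shows "isometric_operator M f"
proof -
  have "f (x + y) = f x + f y" if x: "x \<in> M" and y: "y \<in> M" for x y
  proof -
    let ?z = "f (x + y) - (f x + f y)"
    have "x + y \<in> M" using M x y by (simp add: complex_vector.subspace_add)
    then have "cinner ?z ?z = 0" using x y by (simp add: cinner_linear f)
    then show ?thesis by (simp add: cinner_same)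
  qed
  moreover have "f (a *\<^sub>C x) = a *\<^sub>C f x" if x: "x \<in> M" for a x
  proof -
    let ?z = "f (a *\<^sub>C x) - a *\<^sub>C f x"
    have "a *\<^sub>C x \<in> M" using M x by (simp add: complex_vector.subspace_scale)
    then have "cinner ?z ?z = 0" using x by (simp add: cinner_linear f)
    then show ?thesis by (simp add: cinner_same)
  qed
  ultimately show ?thesis using M f by (simp add: isometric_operator_def linear_operator_def)
qed

lemma cinner_preserving_norm_diff:
  assumes "cinner b b = cinner a a" "cinner b b' = cinner a a'" "cinner b' b' = cinner a' a'"
  shows "norm (b - b') = norm (a - a')"
proof -
  have "(norm (b - b'))\<^sup>2 = (norm (a - a'))\<^sup>2"
    unfolding norm_diff_sq using assms by (simp add: norm_sq_cinner)
  then show ?thesis by (simp add: power2_eq_iff_nonneg)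
qed

text \<open>The graph of the linear map sending each \<open>a i\<close> to \<open>b i\<close>, taken
  as a relation because it is not yet known to be single-valued. The step rule has the shape of
  \<open>complex_vector.span_induct_alt\<close>.\<close>

inductive_set parallel_span ::
  "('i \<Rightarrow> 'a::complex_hilbert_space) \<Rightarrow> ('i \<Rightarrow> 'b::complex_hilbert_space) \<Rightarrow> ('a \<times> 'b) set"
  for a b where
  zero: "(0, 0) \<in> parallel_span a b"
| step: "(p, q) \<in> parallel_span a b \<Longrightarrow> (c *\<^sub>C a i + p, c *\<^sub>C b i + q) \<in> parallel_span a b"

lemma Domain_parallel_span: "Domain (parallel_span a b) = complex_vector.span (range a)"
proof (intro equalityI subsetI)
  fix p assume "p \<in> Domain (parallel_span a b)"
  then obtain q where "(p, q) \<in> parallel_span a b" by blast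
  then show "p \<in> complex_vector.span (range a)"
    by induction (simp_all add: complex_vector.span_zero complex_vector.span_add
        complex_vector.span_scale complex_vector.span_base)
next
  fix p assume "p \<in> complex_vector.span (range a)"
  then show "p \<in> Domain (parallel_span a b)"
    by (induction rule: complex_vector.span_induct_alt) (auto intro: zero step)
qed

lemma Range_parallel_span: "Range (parallel_span a b) = complex_vector.span (range b)"
proof (intro equalityI subsetI)
  fix q assume "q \<in> Range (parallel_span a b)"
  then obtain p where "(p, q) \<in> parallel_span a b" by blast
  then show "q \<in> complex_vector.span (range b)"
    by induction (simp_all add: complex_vector.span_zero complex_vector.span_add
        complex_vector.span_scale complex_vector.span_base)
next
  fix p assume "p \<in> complex_vector.span (range b)"
  then show "p \<in> Range (parallel_span a b)"
    by (induction rule: complex_vector.span_induct_alt) (auto intro: zero step)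
qed

lemma parallel_span_cinner:
  assumes gram: "\<And>i j. cinner (b i) (b j) = cinner (a i) (a j)"
    and pq: "(p, q) \<in> parallel_span a b" and pq': "(p', q') \<in> parallel_span a b"
  shows "cinner q q' = cinner p p'"
proof -
  have "cinner (b j) q = cinner (a j) p" for j
    using pq by induction (simp_all add: cinner_linear gram)
  then have *: "cinner q (b j) = cinner p (a j)" for j by (metis cinner_commute)
  show ?thesis using pq' by induction (simp_all add: cinner_linear *)
qed

text \<open>Equal Gram matrices make the relation \<open>parallel_span\<close> single-valued and
  distance preserving, so it extends by uniform continuity to the closed spans.\<close>

lemma gram_isometry:
  fixes a :: "'i \<Rightarrow> 'a::complex_hilbert_space" and b :: "'i \<Rightarrow> 'b::complex_hilbert_space"
  assumes gram: "\<And>i j. cinner (b i) (b j) = cinner (a i) (a j)"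
  defines "M \<equiv> closure (complex_vector.span (range a))"
    and "M' \<equiv> closure (complex_vector.span (range b))"
  shows "\<exists>f. (\<forall>i. f (a i) = b i) \<and> isometric_operator M f \<and> f ` M = M'"
proof -
  let ?A = "complex_vector.span (range a)" and ?B = "complex_vector.span (range b)"
  let ?G = "parallel_span a b"
  define f where "f p = (SOME q. (p, q) \<in> ?G)" for p
  have G: "(p, f p) \<in> ?G" if "p \<in> ?A" for p
    using that unfolding f_def Domain_parallel_span[of a b, symmetric] by (metis DomainE someI)
  have c: "cinner (f x) (f y) = cinner x y" if "x \<in> ?A" "y \<in> ?A" for x y
    using parallel_span_cinner[of b a, OF gram G[OF that(1)] G[OF that(2)]] .
  have nd: "norm (f x - f y) = norm (x - y)" if "x \<in> ?A" "y \<in> ?A" for x y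
    using that by (intro cinner_preserving_norm_diff c)
  have fG: "q = f p" if "(p, q) \<in> ?G" for p q
  proof -
    have p: "p \<in> ?A" using that Domain_parallel_span[of a b] by blast
    \<comment> \<open>Single-valuedness: two images of the same \<open>p\<close> are as far apart as
      \<open>p\<close> is from itself.\<close>
    have "norm (q - f p) = norm (p - p)"
      using parallel_span_cinner[of b a, OF gram] that G[OF p] by (intro cinner_preserving_norm_diff) auto
    then show ?thesis by simp
  qed
  have "uniformly_continuous_on ?A f"
    unfolding uniformly_continuous_on_def dist_norm using nd by auto
  from uniformly_continuous_on_extension_on_closure[OF this]
  obtain g where g: "uniformly_continuous_on M g" "\<And>x. x \<in> ?A \<Longrightarrow> f x = g x"
    unfolding M_def by metis
  have lim: "(\<lambda>n. f (x n)) \<longlonglongrightarrow> g l" if "\<And>n. x n \<in> ?A" "x \<longlonglongrightarrow> l" for x l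
  proof -
    have "l \<in> M" unfolding M_def closure_sequential using that by blast
    moreover have "x n \<in> M" for n unfolding M_def using that closure_subset by blast
    ultimately have "(\<lambda>n. g (x n)) \<longlonglongrightarrow> g l"
      using uniformly_continuous_imp_continuous[OF g(1)] that(2)
      unfolding continuous_on_sequentially comp_def by blast
    then show ?thesis using g(2) that(1) by simp
  qed
  have cg: "cinner (g x) (g y) = cinner x y" if x: "x \<in> M" and y: "y \<in> M" for x y
  proof -
    obtain s where s: "\<And>n. s n \<in> ?A" "s \<longlonglongrightarrow> x"
      using x unfolding M_def closure_sequential by blast
    obtain t where t: "\<And>n. t n \<in> ?A" "t \<longlonglongrightarrow> y"
      using y unfolding M_def closure_sequential by blast
    have "(\<lambda>n. cinner (f (s n)) (f (t n))) \<longlonglongrightarrow> cinner (g x) (g y)"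
      by (intro tendsto_cinner lim s t)
    then have "(\<lambda>n. cinner (s n) (t n)) \<longlonglongrightarrow> cinner (g x) (g y)" using s t by (simp add: c)
    moreover have "(\<lambda>n. cinner (s n) (t n)) \<longlonglongrightarrow> cinner x y" by (intro tendsto_cinner s t)
    ultimately show ?thesis by (rule LIMSEQ_unique)
  qed
  have iso: "isometric_operator M g"
    unfolding M_def by (rule cinner_preserving_linear)
      (use cg in \<open>auto simp: M_def intro: subspace_closure complex_vector.subspace_span\<close>)
  have ab: "g (a i) = b i" for i
  proof -
    have "(1 *\<^sub>C a i + 0, 1 *\<^sub>C b i + 0) \<in> ?G" by (intro step zero)
    then show ?thesis using fG[of "a i" "b i"] g(2)[of "a i"]
      by (simp add: scaleC_one complex_vector.span_base)
  qed
  have fB: "f x \<in> ?B" if "x \<in> ?A" for x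
    using G[OF that] Range_parallel_span[of a b] by blast
  have "g ` M = M'"
  proof (intro equalityI subsetI)
    fix y assume "y \<in> g ` M"
    then obtain x where x: "x \<in> M" "y = g x" by blast
    then obtain s where s: "\<And>n. s n \<in> ?A" "s \<longlonglongrightarrow> x"
      unfolding M_def closure_sequential by blast
    then show "y \<in> M'" unfolding M'_def closure_sequential x(2)
      by (intro exI[of _ "\<lambda>n. f (s n)"]) (simp add: fB lim)
  next
    fix y assume "y \<in> M'"
    then obtain t where t: "\<And>n. t n \<in> ?B" "t \<longlonglongrightarrow> y" unfolding M'_def closure_sequential by blast
    have "\<exists>x\<in>?A. f x = t n" for n
    proof -
      have "t n \<in> Range ?G" using t(1) by (simp add: Range_parallel_span)
      then obtain p where p: "(p, t n) \<in> ?G" by blast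
      then have "p \<in> ?A" using Domain_parallel_span[of a b] by blast
      with fG[OF p] show ?thesis by auto
    qed
    then obtain s where s: "\<And>n. s n \<in> ?A" "\<And>n. f (s n) = t n" by metis
    \<comment> \<open>Preimages of a Cauchy sequence form a Cauchy sequence, so the image of the
      closed span is the whole target.\<close>
    have "norm (s m - s n) = norm (t m - t n)" for m n using nd[OF s(1) s(1)] s(2) by simp
    then have "Cauchy s" using LIMSEQ_imp_Cauchy[OF t(2)] by (simp add: Cauchy_iff)
    then obtain x where x: "s \<longlonglongrightarrow> x" by (auto simp: Cauchy_convergent_iff convergent_def)
    have "x \<in> M" unfolding M_def closure_sequential using s(1) x by blast
    moreover have "g x = y" using lim[OF s(1) x] t(2) s(2) by (simp add: LIMSEQ_unique)
    ultimately show "y \<in> g ` M" by blast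
  qed
  with ab iso show ?thesis by blast
qed

text \<open>\<open>f\<close> on \<open>M\<close> and the identity on the orthogonal complement;
  because \<open>f\<close> maps \<open>M\<close> onto itself, the two pieces stay orthogonal and
  fill the space.\<close>

lemma unitary_extension:
  assumes M: "complex_vector.subspace M" "closed M" and f: "isometric_operator M f" "f ` M = M"
  shows "\<exists>U. unitary_operator U \<and> (\<forall>x\<in>M. U x = f x)"
proof -
  define p where "p = orthogonal_projection M"
  define U where "U h = f (p h) + (h - p h)" for h
  have p: "p x \<in> M" for x unfolding p_def by (rule orthogonal_projection_in[OF M])
  have orth: "cinner (x - p x) y = 0" "cinner y (x - p x) = 0" if "y \<in> M" for x y
    using diff_orthogonal_projection_in[OF M, of x] that cinner_commute[of y]
    by (auto simp: orthogonal_complement_def p_def)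
  have fM: "f (p x) \<in> M" for x using f(2) p by blast
  have "cinner (U x) (U y) = cinner x y" for x y
  proof -
    have "cinner (U x) (U y) = cinner (p x) (p y) + cinner (x - p x) (y - p y)"
      unfolding U_def cinner_add_left cinner_add_right
      using f(1) p by (simp add: orth fM isometric_operator_def)
    also have "\<dots> = cinner (p x + (x - p x)) (p y + (y - p y))"
      unfolding cinner_add_left cinner_add_right using p by (simp add: orth)
    finally show ?thesis by simp
  qed
  then have "isometric_operator UNIV U" by (intro cinner_preserving_linear) auto
  moreover have "y \<in> range U" for y
  proof -
    have "p y \<in> f ` M" using f(2) p by simp
    then obtain m where m: "m \<in> M" "f m = p y" by auto
    have "p (m + (y - p y)) = m"
      unfolding p_def using m(1) orth[of _ y]
      by (intro orthogonal_projection_eqI[OF M]) (simp_all add: cinner_add_left p_def)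
    then have "U (m + (y - p y)) = y" by (simp add: U_def m(2))
    then show ?thesis by (metis rangeI)
  qed
  moreover have "U x = f x" if "x \<in> M" for x
    using orthogonal_projection_ident[OF M that] by (simp add: U_def p_def)
  ultimately show ?thesis unfolding unitary_operator_def by blast
qed

text \<open>The vector at \<open>(n, i)\<close> plays the role of \<open>U^n J (q i)\<close>. The
  kernel depends only on \<open>n - m\<close>, so the shift in \<open>n\<close> preserves the Gram
  matrix, and it permutes the family. The case \<open>n = m\<close> is the Gram matrix of
  \<open>q\<close>, which makes \<open>J\<close> isometric.\<close>

lemma toeplitz_dilation:
  fixes q :: "nat \<Rightarrow> 'a::complex_hilbert_space" and \<kappa> :: "int \<Rightarrow> nat \<Rightarrow> nat \<Rightarrow> complex"
  assumes dense: "closure (range q) = UNIV"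
    and pos: "positive_kernel (\<lambda>(n, i) (m, j). \<kappa> (n - m) i j)"
    and unit: "\<And>i j. \<kappa> 0 i j = cinner (q i) (q j)"
  shows "\<exists>(J :: 'a \<Rightarrow> ell2) U. isometric_operator UNIV J \<and> unitary_operator U \<and>
    (\<forall>n i j. cinner ((U ^^ n) (J (q i))) (J (q j)) = \<kappa> (int n) i j)"
proof -
  let ?e = "from_nat_into (UNIV :: (int \<times> nat) set)"
  let ?k = "\<lambda>(n, i) (m, j). \<kappa> (n - m) i j"
  have bij: "bij ?e"
    by (rule bij_betw_from_nat_into) (auto simp: finite_prod infinite_UNIV_char_0)
  obtain v0 :: "nat \<Rightarrow> ell2" where v0: "\<And>s t. cinner (v0 s) (v0 t) = ?k (?e s) (?e t)"
    using gram_vectors_nat[OF positive_kernel_pullback[OF pos bij_is_inj[OF bij]]] by blast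
  define v where "v s = v0 (inv ?e s)" for s
  have "cinner (v s) (v t) = ?k s t" for s t
    using v0 by (simp add: v_def surj_f_inv_f[OF bij_is_surj[OF bij]])
  then have v: "cinner (v (n, i)) (v (m, j)) = \<kappa> (n - m) i j" for n i m j by simp
  obtain J where J: "\<And>i. J (q i) = v (0, i)"
    "isometric_operator (closure (complex_vector.span (range q))) J"
    using gram_isometry[of "\<lambda>i. v (0, i)" q] by (auto simp: v unit)
  have "closure (range q) \<subseteq> closure (complex_vector.span (range q))"
    by (intro closure_mono complex_vector.span_superset)
  then have J': "isometric_operator UNIV J" using J(2) dense by (metis top.extremum_uniqueI)
  define w where "w = (\<lambda>(n, i). v (n + 1, i))"
  have "range w = range v"
  proof -
    have "surj (\<lambda>(n :: int, i :: nat). (n + 1, i))"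
      by (rule surjI[of _ "\<lambda>(n, i). (n - 1, i)"]) auto
    moreover have "w = v \<circ> (\<lambda>(n, i). (n + 1, i))" by (auto simp: w_def)
    ultimately show ?thesis by (simp only: image_comp[symmetric])
  qed
  let ?M = "closure (complex_vector.span (range v))"
  have "cinner (w s) (w t) = cinner (v s) (v t)" for s t
    by (cases s; cases t) (simp add: w_def v)
  from gram_isometry[of w v, OF this] \<open>range w = range v\<close>
  obtain f where f: "\<And>s. f (v s) = w s" "isometric_operator ?M f" "f ` ?M = ?M" by auto
  obtain U where U: "unitary_operator U" "\<And>x. x \<in> ?M \<Longrightarrow> U x = f x"
    using unitary_extension[OF subspace_closure[OF complex_vector.subspace_span] closed_closure f(2,3)]
    by blast
  have "v s \<in> ?M" for s
    using closure_subset complex_vector.span_superset by (meson rangeI subsetD)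
  then have "U (v (n, i)) = v (n + 1, i)" for n i using f(1) by (simp add: U(2) w_def)
  then have "(U ^^ n) (J (q i)) = v (int n, i)" for n i
    by (induction n) (simp_all add: J(1) add.commute)
  then have "cinner ((U ^^ n) (J (q i))) (J (q j)) = \<kappa> (int n) i j" for n i j by (simp add: J(1) v)
  with J' U(1) show ?thesis by blast
qed

section \<open>Resolvents of analytic families of contractions\<close>

text \<open>Passage from norm differentiability to strong differentiability, the form in which the
  converse consumes analyticity.\<close>

lemma operator_analytic_tendsto:
  assumes "operator_analytic_on F \<Omega> N N'" "z \<in> \<Omega>"
  shows "\<exists>G. \<forall>x\<in>N. ((\<lambda>w. inverse (w - z) *\<^sub>C (F w x - F z x)) \<longlongrightarrow> G x) (at z)"
proof -
  obtain G where G: "\<And>e. e > 0 \<Longrightarrow> \<forall>\<^sub>F w in at z. \<forall>x\<in>N.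
      norm (inverse (w - z) *\<^sub>C (F w x - F z x) - G x) \<le> e * norm x"
    using assms unfolding operator_analytic_on_def by meson
  have "((\<lambda>w. inverse (w - z) *\<^sub>C (F w x - F z x)) \<longlongrightarrow> G x) (at z)" if x: "x \<in> N" for x
  proof (rule tendsto_of_norm_bound)
    fix e :: real assume "e > 0"
    from G[OF this] show "\<forall>\<^sub>F w in at z. norm (inverse (w - z) *\<^sub>C (F w x - F z x) - G x) \<le> e * norm x"
      by (rule eventually_mono) (use x in blast)
  qed simp
  then show ?thesis by blast
qed

lemma tendsto_from_difference_quotient:
  fixes f :: "complex \<Rightarrow> 'a::complex_hilbert_space"
  assumes "((\<lambda>w. inverse (w - z) *\<^sub>C (f w - f z)) \<longlongrightarrow> g) (at z)"
  shows "(f \<longlongrightarrow> f z) (at z)"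
proof -
  have "((\<lambda>w. f z + (w - z) *\<^sub>C inverse (w - z) *\<^sub>C (f w - f z)) \<longlongrightarrow> f z + (z - z) *\<^sub>C g) (at z)"
    by (intro tendsto_intros assms)
  then have "((\<lambda>w. f z + (w - z) *\<^sub>C inverse (w - z) *\<^sub>C (f w - f z)) \<longlongrightarrow> f z) (at z)" by simp
  moreover have "\<forall>\<^sub>F w in at z. f z + (w - z) *\<^sub>C inverse (w - z) *\<^sub>C (f w - f z) = f w"
    unfolding eventually_at_filter by (intro always_eventually) (simp add: scaleC_scaleC scaleC_one)
  ultimately show ?thesis by (rule Lim_transform_eventually)
qed

section \<open>Fourier coefficients of holomorphic functions on circles about 0\<close>

definition taylor_coefficient :: "(complex \<Rightarrow> complex) \<Rightarrow> nat \<Rightarrow> complex" where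
  "taylor_coefficient f n = (deriv ^^ n) f 0 / fact n"

definition character :: "int \<Rightarrow> real \<Rightarrow> complex" where
  "character n t = exp (of_int n * (2 * of_real pi * \<i> * of_real t))"

lemma character_add: "character (n + m) t = character n t * character m t"
  by (simp add: character_def ring_distribs exp_add)

lemma character_zero [simp]: "character 0 t = 1"
  by (simp add: character_def)

lemma cnj_character: "cnj (character n t) = character (- n) t"
  by (simp add: character_def exp_cnj)

lemma character_nat: "character (int n) t = character 1 t ^ n"
  by (simp add: character_def exp_of_nat_mult)

lemma norm_character [simp]: "cmod (character n t) = 1"
  by (simp add: character_def)

text \<open>Cauchy's formula for the derivatives at 0 on the circle of radius \<open>r\<close>,
  parametrised over the unit interval as in \<open>circlepath\<close>; that is why
  \<open>character\<close> contains the factor 2 pi.\<close>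

lemma taylor_coefficient_integral_nat:
  assumes f: "f holomorphic_on ball 0 1" and r: "0 < r" "r < 1"
  shows "((\<lambda>t. f (of_real r * character 1 t) * character (- int n) t) has_integral
    of_real (r ^ n) * taylor_coefficient f n) {0..1}"
proof -
  have sub: "cball 0 r \<subseteq> (ball 0 1 :: complex set)" "ball 0 r \<subseteq> (ball 0 1 :: complex set)"
    using r by auto
  have "((\<lambda>u. f u / (u - 0) ^ Suc n) has_contour_integral
      ((2 * pi * \<i>) / fact n * (deriv ^^ n) f 0)) (circlepath 0 r)"
    using r by (intro Cauchy_has_contour_integral_higher_derivative_circlepath
        holomorphic_on_imp_continuous_on holomorphic_on_subset[OF f] sub) auto
  then have *: "((\<lambda>t. f (circlepath 0 r t) / (circlepath 0 r t) ^ Suc n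
      * vector_derivative (circlepath 0 r) (at t within {0..1})) has_integral
      ((2 * pi * \<i>) / fact n * (deriv ^^ n) f 0)) {0..1}"
    by (simp add: has_contour_integral_def)
  have cp: "circlepath 0 r t = of_real r * character 1 t" for t
    by (simp add: circlepath character_def)
  have vd: "vector_derivative (circlepath 0 r) (at t within {0..1}) = 2 * pi * \<i> * of_real r * character 1 t"
    if "t \<in> {0..1}" for t
    using that by (simp add: vector_derivative_circlepath01 character_def)
  have inv: "character (- int n) t = inverse (character 1 t ^ n)" for t
    by (simp add: character_nat[symmetric]) (simp add: character_def exp_minus)
  have nz: "character 1 t \<noteq> 0" for t by (simp add: character_def)
  \<comment> \<open>On the circle, \<open>du / u^(n+1)\<close> equals \<open>2 pi i r^(-n)\<close>
    times the character of index \<open>-n\<close> times \<open>dt\<close>.\<close>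
  have "((\<lambda>t. (2 * pi * \<i> / of_real r ^ n) * (f (of_real r * character 1 t) * character (- int n) t)) has_integral
      ((2 * pi * \<i>) / fact n * (deriv ^^ n) f 0)) {0..1}"
    by (rule has_integral_eq[OF _ *])
       (use r nz in \<open>simp add: cp vd inv field_simps power_mult_distrib\<close>)
  from has_integral_mult_right[OF this, of "of_real r ^ n / (2 * pi * \<i>)"] r
  show ?thesis by (simp add: taylor_coefficient_def field_simps)
qed

lemma taylor_coefficient_integral:
  assumes f: "f holomorphic_on ball 0 1" and r: "0 < r" "r < 1"
  shows "((\<lambda>t. f (of_real r * character 1 t) * character (- n) t) has_integral
    (if n \<ge> 0 then of_real (r ^ nat n) * taylor_coefficient f (nat n) else 0)) {0..1}"
proof (cases "n \<ge> 0")
  case True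
  then show ?thesis using taylor_coefficient_integral_nat[OF assms, of "nat n"] by simp
next
  case False
  define m where "m = nat (- n)"
  have m: "- n = int m" "m > 0" using False by (auto simp: m_def)
  \<comment> \<open>A negative coefficient of \<open>f\<close> is, up to a power of
    \<open>r\<close>, the value at 0 of \<open>f u * u ^ m\<close>, which vanishes as
    \<open>m > 0\<close>.\<close>
  have "(\<lambda>u. f u * u ^ m) holomorphic_on ball 0 1" by (intro holomorphic_intros f)
  from taylor_coefficient_integral_nat[OF this r, of 0]
  have "((\<lambda>t. of_real (r ^ m) * (f (of_real r * character 1 t) * character (- n) t)) has_integral 0) {0..1}"
    using m(2) by (simp add: taylor_coefficient_def m(1) character_nat power_mult_distrib zero_power mult_ac)
  from has_integral_mult_right[OF this, of "1 / of_real (r ^ m)"] r False show ?thesis by simp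
qed

lemma taylor_coefficient_integral_cnj:
  assumes f: "f holomorphic_on ball 0 1" and r: "0 < r" "r < 1"
  shows "((\<lambda>t. cnj (f (of_real r * character 1 t)) * character (- n) t) has_integral
    (if n \<le> 0 then of_real (r ^ nat (- n)) * cnj (taylor_coefficient f (nat (- n))) else 0)) {0..1}"
proof -
  have "(cnj \<circ> (\<lambda>t. f (of_real r * character 1 t) * character (- (- n)) t) has_integral
    cnj (if - n \<ge> 0 then of_real (r ^ nat (- n)) * taylor_coefficient f (nat (- n)) else 0)) {0..1}"
    unfolding has_integral_cnj by (rule taylor_coefficient_integral[OF assms])
  then show ?thesis by (simp add: comp_def cnj_character if_distrib[of cnj] cong: if_cong)
qed

text \<open>Differentiability is stated vector by vector; it enters through the holomorphy of the
  scalar functions \<open>cinner (R w x) y\<close>.\<close>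

locale analytic_contractions =
  fixes T :: "complex \<Rightarrow> 'a::complex_hilbert_space \<Rightarrow> 'a"
  assumes contraction: "cmod z < 1 \<Longrightarrow> contraction (T z)"
    and analytic: "cmod z < 1 \<Longrightarrow> \<exists>g. ((\<lambda>w. inverse (w - z) *\<^sub>C (T w x - T z x)) \<longlongrightarrow> g) (at z)"
begin

abbreviation R :: "complex \<Rightarrow> 'a \<Rightarrow> 'a" where "R z \<equiv> resolvent z (T z)"

lemma near: "cmod z < 1 \<Longrightarrow> \<forall>\<^sub>F w in at z. cmod w < 1"
  using eventually_at_in_open'[of "ball 0 1" z] by simp

text \<open>Joint continuity in point and vector: \<open>R w\<close> is bounded by
  \<open>1 / (1 - cmod w)\<close> near \<open>z\<close>, and the resolvent identity reduces the rest
  to continuity of \<open>w T w\<close> at the single vector \<open>R z g\<close>.\<close>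

lemma resolvent_tendsto:
  assumes z: "cmod z < 1" and q: "(q \<longlongrightarrow> g) (at z)"
  shows "((\<lambda>w. R w (q w)) \<longlongrightarrow> R z g) (at z)"
proof -
  define u where "u = R z g"
  obtain g' where "((\<lambda>w. inverse (w - z) *\<^sub>C (T w u - T z u)) \<longlongrightarrow> g') (at z)"
    using analytic[OF z] by blast
  then have Tu: "((\<lambda>w. T w u) \<longlongrightarrow> T z u) (at z)" by (rule tendsto_from_difference_quotient)
  define b where "b w = (norm (q w - g) + norm (w *\<^sub>C T w u - z *\<^sub>C T z u)) / (1 - cmod w)" for w
  have "(b \<longlongrightarrow> (norm (g - g) + norm (z *\<^sub>C T z u - z *\<^sub>C T z u)) / (1 - cmod z)) (at z)"
    unfolding b_def using z by (intro tendsto_intros q Tu) auto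
  then have b: "(b \<longlongrightarrow> 0) (at z)" by simp
  have "\<forall>\<^sub>F w in at z. norm (R w (q w) - R z g) \<le> b w"
    using near[OF z]
  proof eventually_elim
    case (elim w)
    note c = contraction[OF elim]
    have "R w (q w) - R z g = R w (q w - g) + (R w g - R z g)"
      by (simp add: linear_diff[OF bounded_linear.linear[OF bounded_linear_resolvent[OF c elim]]])
    also have "R w g - R z g = R w (w *\<^sub>C T w u - z *\<^sub>C T z u)"
      unfolding u_def by (rule resolvent_difference[OF c elim contraction[OF z] z])
    also have "norm (R w (q w - g) + \<dots>) \<le> norm (q w - g) / (1 - cmod w)
        + norm (w *\<^sub>C T w u - z *\<^sub>C T z u) / (1 - cmod w)"
      by (intro norm_triangle_mono norm_resolvent_le[OF c elim])
    also have "\<dots> = b w" by (simp add: b_def add_divide_distrib)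
    finally show ?case .
  qed
  then have "((\<lambda>w. R w (q w) - R z g) \<longlongrightarrow> 0) (at z)" by (rule Lim_null_comparison[OF _ b])
  then show ?thesis by (simp only: LIM_zero_iff)
qed

text \<open>The derivative is kept explicit because at \<open>z = 0\<close> the unknown
  \<open>g\<close> drops out, which identifies the first Taylor coefficient with
  \<open>T 0\<close>.\<close>

lemma resolvent_derivative:
  assumes z: "cmod z < 1"
  shows "\<exists>g. ((\<lambda>w. cinner (R w x) y) has_field_derivative cinner (R z (T z (R z x) + z *\<^sub>C g)) y) (at z)"
proof -
  define v where "v = R z x"
  obtain g where g: "((\<lambda>w. inverse (w - z) *\<^sub>C (T w v - T z v)) \<longlongrightarrow> g) (at z)"
    using analytic[OF z] by blast
  note Tv = tendsto_from_difference_quotient[OF g]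
  \<comment> \<open>For \<open>w\<close> different from \<open>z\<close> this is the difference
    quotient of \<open>w T w v\<close>, arranged by the product rule.\<close>
  let ?q = "\<lambda>w. T w v + z *\<^sub>C inverse (w - z) *\<^sub>C (T w v - T z v)"
  have "(?q \<longlongrightarrow> T z v + z *\<^sub>C g) (at z)" by (intro tendsto_intros Tv g)
  then have "((\<lambda>w. cinner (R w (?q w)) y) \<longlongrightarrow> cinner (R z (T z v + z *\<^sub>C g)) y) (at z)"
    by (rule tendsto_cinner[OF resolvent_tendsto[OF z] tendsto_const])
  moreover have "\<forall>\<^sub>F w in at z. cinner (R w (?q w)) y
      = (cinner (R w x) y - cinner (R z x) y) / (w - z)"
    using near[OF z] eventually_neq_at_within[of z z UNIV]
  proof eventually_elim
    case (elim w)
    note c = contraction[OF elim(1)]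
    have "w *\<^sub>C T w v - z *\<^sub>C T z v = (w - z) *\<^sub>C ?q w"
    proof -
      have "(w - z) *\<^sub>C ?q w = (w - z) *\<^sub>C T w v + ((w - z) * (z * inverse (w - z))) *\<^sub>C (T w v - T z v)"
        by (simp only: scaleC_add_right scaleC_scaleC)
      also have "(w - z) * (z * inverse (w - z)) = z" using elim(2) by (simp add: field_simps)
      finally show ?thesis by (simp add: scaleC_linear)
    qed
    then have "R w x - R z x = (w - z) *\<^sub>C R w (?q w)"
      using resolvent_difference[OF c elim(1) contraction[OF z] z, of x]
        resolvent_scaleC[OF c elim(1)] by (simp add: v_def)
    then have "cinner (R w x) y - cinner (R z x) y = (w - z) * cinner (R w (?q w)) y"
      by (metis cinner_diff_left cinner_scaleC_left)
    then show ?case using elim(2) by simp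
  qed
  ultimately have "((\<lambda>w. (cinner (R w x) y - cinner (R z x) y) / (w - z)) \<longlongrightarrow>
      cinner (R z (T z v + z *\<^sub>C g)) y) (at z)"
    by (rule Lim_transform_eventually)
  then show ?thesis unfolding has_field_derivative_iff v_def by blast
qed

lemma resolvent_holomorphic: "(\<lambda>w. cinner (R w x) y) holomorphic_on ball 0 1"
  unfolding holomorphic_on_open[OF open_ball] using resolvent_derivative by force

text \<open>The coefficients \<open>C_n\<close> are kept as sesquilinear forms, so that scalar
  complex analysis applies.\<close>

definition coefficient :: "nat \<Rightarrow> 'a \<Rightarrow> 'a \<Rightarrow> complex" where
  "coefficient n x y = taylor_coefficient (\<lambda>w. cinner (R w x) y) n"

definition toeplitz :: "int \<Rightarrow> 'a \<Rightarrow> 'a \<Rightarrow> complex" where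
  "toeplitz n x y = (if n \<ge> 0 then coefficient (nat n) x y else cnj (coefficient (nat (- n)) y x))"

lemma resolvent_at_zero: "R 0 x = x"
  by (rule resolvent_eqI) (auto intro: contraction)

lemma coefficient_zero: "coefficient 0 x y = cinner x y"
  by (simp add: coefficient_def taylor_coefficient_def resolvent_at_zero)

lemma coefficient_one: "coefficient 1 x y = cinner (T 0 x) y"
proof -
  obtain g where "((\<lambda>w. cinner (R w x) y) has_field_derivative
      cinner (R 0 (T 0 (R 0 x) + 0 *\<^sub>C g)) y) (at 0)"
    using resolvent_derivative[of 0 x y] by auto
  then have "deriv (\<lambda>w. cinner (R w x) y) 0 = cinner (T 0 x) y"
    unfolding resolvent_at_zero by (simp add: DERIV_imp_deriv)
  then show ?thesis by (simp add: coefficient_def taylor_coefficient_def)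
qed

lemma resolvent_sums:
  "cmod z < 1 \<Longrightarrow> (\<lambda>n. z ^ n * coefficient n x y) sums cinner (R z x) y"
  using holomorphic_power_series[OF resolvent_holomorphic, of z x y]
  by (simp add: coefficient_def taylor_coefficient_def mult.commute)

text \<open>The form of \<open>R z + (R z)^* - 1\<close>; when \<open>T\<close> is a constant
  unitary operator this is its Poisson kernel.\<close>

definition poisson_form :: "complex \<Rightarrow> 'a \<Rightarrow> 'a \<Rightarrow> complex" where
  "poisson_form z x y = cinner (R z x) y + cinner x (R z y) - cinner x y"

text \<open>With \<open>h = R z g\<close> we have \<open>g = h - z T h\<close> and the form at \<open>g\<close> is \<open>\<parallel>h\<parallel>\<^sup>2 - \<parallel>z T h\<parallel>\<^sup>2\<close>.\<close>

lemma poisson_form_nonneg: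
  assumes z: "cmod z < 1"
  shows "0 \<le> Re (poisson_form z g g)"
proof -
  define h where "h = R z g"
  have h: "h - g = z *\<^sub>C T z h"
    using resolvent_eq[OF contraction[OF z] z, of g] by (simp add: h_def algebra_simps)
  have "norm (z *\<^sub>C T z h) \<le> 1 * norm h"
    unfolding norm_scaleC using z contraction_norm[OF contraction[OF z]] by (intro mult_mono) auto
  then have "(norm (h - g))\<^sup>2 \<le> (norm h)\<^sup>2" unfolding h by (intro power_mono) auto
  moreover have "Re (poisson_form z g g) = 2 * Re (cinner h g) - (norm g)\<^sup>2"
    using arg_cong[OF cinner_commute[of g h], of Re] by (simp add: poisson_form_def h_def norm_sq_cinner)
  ultimately show ?thesis by (simp add: norm_diff_sq)
qed

text \<open>The analytic part supplies the coefficients \<open>n >= 0\<close>, the conjugate part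
  those with \<open>n <= 0\<close>. Index 0 would be counted twice; the subtracted
  \<open>cinner x y\<close>, equal to \<open>C_0\<close>, corrects this.\<close>

lemma poisson_form_integral:
  assumes r: "0 < r" "r < 1"
  shows "((\<lambda>t. poisson_form (of_real r * character 1 t) x y * character (- n) t) has_integral
    of_real (r ^ nat \<bar>n\<bar>) * toeplitz n x y) {0..1}"
proof -
  let ?z = "\<lambda>t. of_real r * character 1 t"
  have 1: "((\<lambda>t. cinner (R (?z t) x) y * character (- n) t) has_integral
      (if n \<ge> 0 then of_real (r ^ nat n) * coefficient (nat n) x y else 0)) {0..1}"
    unfolding coefficient_def by (rule taylor_coefficient_integral[OF resolvent_holomorphic r])
  have "cnj (cinner (R (?z t) y) x) = cinner x (R (?z t) y)" for t by (metis cinner_commute)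
  then have 2: "((\<lambda>t. cinner x (R (?z t) y) * character (- n) t) has_integral
      (if n \<le> 0 then of_real (r ^ nat (- n)) * cnj (coefficient (nat (- n)) y x) else 0)) {0..1}"
    using taylor_coefficient_integral_cnj[OF resolvent_holomorphic r, of y x n]
    by (simp only: coefficient_def)
  have 3: "((\<lambda>t. cinner x y * character (- n) t) has_integral
      (if n \<ge> 0 then of_real (r ^ nat n) * taylor_coefficient (\<lambda>_. cinner x y) (nat n) else 0)) {0..1}"
    using taylor_coefficient_integral[of "\<lambda>_. cinner x y", OF _ r] by simp
  have c: "cnj (cinner y x) = cinner x y" by (metis cinner_commute)
  from has_integral_diff[OF has_integral_add[OF 1 2] 3] show ?thesis
    by (cases "n = 0"; cases "n > 0")
       (simp_all add: poisson_form_def ring_distribs toeplitz_def taylor_coefficient_def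
         coefficient_zero c)
qed

lemma toeplitz_hermitian: "toeplitz (m - n) y x = cnj (toeplitz (n - m) x y)"
proof (cases n m rule: linorder_cases)
  case equal
  have "cnj (cinner x y) = cinner y x" by (metis cinner_commute)
  then show ?thesis using equal by (simp add: toeplitz_def coefficient_zero)
qed (simp_all add: toeplitz_def)

text \<open>The integral over a circle of the nonnegative function
  \<open>poisson_form z (g t) (g t)\<close> is the quadratic form of the damped kernel.\<close>

lemma toeplitz_positive:
  fixes q :: "'i \<Rightarrow> 'a"
  shows "positive_kernel (\<lambda>(n, i) (m, j). toeplitz (n - m) (q i) (q j))"
  unfolding positive_kernel_def
proof (intro conjI allI impI)
  show "(case t of (n, i) \<Rightarrow> \<lambda>(m, j). toeplitz (n - m) (q i) (q j)) s
      = cnj ((case s of (n, i) \<Rightarrow> \<lambda>(m, j). toeplitz (n - m) (q i) (q j)) t)" for s t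
    unfolding case_prod_beta by (rule toeplitz_hermitian)
next
  fix S :: "(int \<times> 'i) set" and c :: "int \<times> 'i \<Rightarrow> complex"
  assume S: "finite S"
  define K where "K s t = toeplitz (fst s - fst t) (q (snd s)) (q (snd t))" for s t
  define P where "P r = Re (\<Sum>s\<in>S. \<Sum>t\<in>S. c s * cnj (c t) *
    (of_real (r ^ nat \<bar>fst s - fst t\<bar>) * K s t))" for r :: real
  have nonneg: "0 \<le> P r" if r: "0 < r" "r < 1" for r
  proof -
    let ?z = "\<lambda>t. of_real r * character 1 t"
    \<comment> \<open>The signs are chosen so that the pair \<open>s\<close>, \<open>t\<close>
      carries the character of index \<open>-(fst s - fst t)\<close>, whose integral selects exactly
      the kernel entry wanted.\<close>
    define g where "g t = (\<Sum>s\<in>S. (c s * character (- fst s) t) *\<^sub>C q (snd s))" for t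
    have z: "cmod (?z t) < 1" for t using r by (simp add: norm_mult)
    have "poisson_form (?z \<tau>) (g \<tau>) (g \<tau>) = (\<Sum>s\<in>S. \<Sum>t\<in>S. c s * cnj (c t) *
        (poisson_form (?z \<tau>) (q (snd s)) (q (snd t)) * character (- (fst s - fst t)) \<tau>))" for \<tau>
    proof -
      have R: "R (?z \<tau>) (g \<tau>) = (\<Sum>s\<in>S. (c s * character (- fst s) \<tau>) *\<^sub>C R (?z \<tau>) (q (snd s)))"
        unfolding g_def linear_sum[OF bounded_linear.linear[OF bounded_linear_resolvent[OF contraction[OF z] z]]]
        by (simp add: resolvent_scaleC[OF contraction[OF z] z])
      have ch: "character (- (n - m)) \<tau> = character (- n) \<tau> * cnj (character (- m) \<tau>)" for n m
        unfolding cnj_character character_add[symmetric] by (simp add: algebra_simps)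
      show ?thesis
        unfolding poisson_form_def R unfolding g_def cinner_sum_left cinner_sum_right
          sum.distrib[symmetric] sum_subtractf[symmetric]
        by (subst sum.swap, intro sum.cong refl) (simp only: cinner_scaleC_left cinner_scaleC_right ch complex_cnj_mult, algebra)
    qed
    moreover have "((\<lambda>\<tau>. \<Sum>s\<in>S. \<Sum>t\<in>S. c s * cnj (c t) *
        (poisson_form (?z \<tau>) (q (snd s)) (q (snd t)) * character (- (fst s - fst t)) \<tau>))
      has_integral (\<Sum>s\<in>S. \<Sum>t\<in>S. c s * cnj (c t) * (of_real (r ^ nat \<bar>fst s - fst t\<bar>) * K s t))) {0..1}"
      unfolding K_def by (intro has_integral_sum S has_integral_mult_right poisson_form_integral r)
    ultimately have "((\<lambda>\<tau>. poisson_form (?z \<tau>) (g \<tau>) (g \<tau>)) has_integral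
        (\<Sum>s\<in>S. \<Sum>t\<in>S. c s * cnj (c t) * (of_real (r ^ nat \<bar>fst s - fst t\<bar>) * K s t))) {0..1}"
      by simp
    from has_integral_Re[OF this] show ?thesis
      unfolding P_def by (rule has_integral_nonneg) (rule poisson_form_nonneg[OF z])
  qed
  \<comment> \<open>\<open>P\<close> is a polynomial in \<open>r\<close>; letting \<open>r\<close>
    tend to 1 removes the damping.\<close>
  have "(P \<longlongrightarrow> P 1) (at_left 1)" unfolding P_def by (intro tendsto_intros)
  moreover have "\<forall>\<^sub>F r in at_left 1. 0 \<le> P r"
    using eventually_at_left_real[of 0 "1::real"] by (rule eventually_mono) (auto intro: nonneg)
  ultimately have "0 \<le> P 1" by (rule tendsto_lowerbound) simp
  then show "0 \<le> Re (\<Sum>s\<in>S. \<Sum>t\<in>S. c s * cnj (c t) *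
      (case s of (n, i) \<Rightarrow> \<lambda>(m, j). toeplitz (n - m) (q i) (q j)) t)"
    by (simp add: P_def K_def case_prod_beta)
qed

end

text \<open>The fixed point equation iterated \<open>N\<close> times gives the partial sum plus a
  remainder of norm at most \<open>cmod z ^ N * norm ?a\<close>.\<close>

lemma neumann_sums:
  assumes U: "contraction U" "cmod z < 1"
  shows "(\<lambda>n. z ^ n *\<^sub>C (U ^^ n) h) sums resolvent z U h"
proof -
  let ?a = "resolvent z U h"
  have a: "?a = (\<Sum>n<N. z ^ n *\<^sub>C (U ^^ n) h) + z ^ N *\<^sub>C (U ^^ N) ?a" for N
  proof (induction N)
    case (Suc N)
    have add: "(U ^^ N) (x + y) = (U ^^ N) x + (U ^^ N) y" for x y
      by (induction N) (simp_all add: contraction_add[OF U(1)])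
    have scale: "(U ^^ N) (b *\<^sub>C x) = b *\<^sub>C (U ^^ N) x" for b x
      by (induction N) (simp_all add: contraction_scaleC[OF U(1)])
    have "(U ^^ N) ?a = (U ^^ N) h + z *\<^sub>C (U ^^ Suc N) ?a"
      by (subst resolvent_eq[OF U]) (simp add: add scale funpow_swap1)
    then have "z ^ N *\<^sub>C (U ^^ N) ?a = z ^ N *\<^sub>C ((U ^^ N) h + z *\<^sub>C (U ^^ Suc N) ?a)"
      by (rule arg_cong[where f = "\<lambda>x. z ^ N *\<^sub>C x"])
    also have "\<dots> = z ^ N *\<^sub>C (U ^^ N) h + z ^ Suc N *\<^sub>C (U ^^ Suc N) ?a"
      by (simp add: scaleC_linear mult.commute)
    finally show ?case unfolding sum.lessThan_Suc add.assoc by (rule trans[OF Suc arg_cong[where f = "(+) _"]])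
  qed (simp add: scaleC_one)
  have Un: "norm ((U ^^ N) x) \<le> norm x" for N x
    by (induction N) (auto intro: order_trans[OF contraction_norm[OF U(1)]])
  have "(\<lambda>N. z ^ N *\<^sub>C (U ^^ N) ?a) \<longlonglongrightarrow> 0"
  proof (rule Lim_null_comparison)
    show "\<forall>\<^sub>F N in sequentially. norm (z ^ N *\<^sub>C (U ^^ N) ?a) \<le> cmod z ^ N * norm ?a"
      using Un by (simp add: norm_power mult_left_mono)
    show "(\<lambda>N. cmod z ^ N * norm ?a) \<longlonglongrightarrow> 0"
      using U(2) by (intro tendsto_mult_left_zero LIMSEQ_power_zero) simp
  qed
  then have "(\<lambda>N. ?a - z ^ N *\<^sub>C (U ^^ N) ?a) \<longlonglongrightarrow> ?a - 0" by (intro tendsto_intros)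
  moreover have "?a - z ^ N *\<^sub>C (U ^^ N) ?a = (\<Sum>n<N. z ^ n *\<^sub>C (U ^^ n) h)" for N
    using a[of N] by (simp add: algebra_simps)
  ultimately show ?thesis by (simp add: sums_def)
qed

text \<open>The dilation is known only through inner products of the \<open>q i\<close>. Density is
  used once in each argument.\<close>

lemma eq_if_cinner_eq_dense:
  fixes A B :: "'a::complex_hilbert_space \<Rightarrow> 'a" and q :: "'i \<Rightarrow> 'a"
  assumes dense: "closure (range q) = UNIV" and A: "bounded_linear A" and B: "bounded_linear B"
    and eq: "\<And>i j. cinner (A (q i)) (q j) = cinner (B (q i)) (q j)"
  shows "A x = B x"
proof -
  have "A (q i) = B (q i)" for i
  proof (rule cinner_ext)
    fix y
    have "closed {y. cinner (A (q i)) y = cinner (B (q i)) y}"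
      by (intro closed_Collect_eq continuous_intros)
    then have "closure (range q) \<subseteq> {y. cinner (A (q i)) y = cinner (B (q i)) y}"
      by (rule closure_minimal[rotated]) (use eq in auto)
    then show "cinner (A (q i)) y = cinner (B (q i)) y" using dense by auto
  qed
  moreover have "closed {x. A x = B x}"
    by (intro closed_Collect_eq linear_continuous_on A B)
  ultimately have "closure (range q) \<subseteq> {x. A x = B x}"
    by (intro closure_minimal) auto
  then show ?thesis using dense by auto
qed

lemma dense_sequence_exists:
  "\<exists>q :: nat \<Rightarrow> 'a::separable_complex_hilbert_space. closure (range q) = UNIV"
proof -
  obtain A :: "'a set" where A: "countable A" "\<And>x e. e > 0 \<Longrightarrow> \<exists>y\<in>A. dist y x < e"
    using separable by blast
  have "A \<noteq> {}" using A(2)[of 1 undefined] by auto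
  then have "range (from_nat_into A) = A" by (rule range_from_nat_into) (rule A(1))
  moreover have "closure A = UNIV" using A(2) by (auto simp: closure_approachable)
  ultimately show ?thesis by metis
qed

section \<open>Generalized resolvents outside the disc\<close>

text \<open>Outside the disc, \<open>1 - zU = -zU (1 - z^-1 U^-1)\<close> reduces the claim to the
  contraction \<open>U^-1\<close> at the point \<open>1/z\<close>.\<close>

lemma unitary_resolvent_eq:
  assumes U: "unitary_operator U" and z: "cmod z \<noteq> 1"
  shows "resolvent z U h = h + z *\<^sub>C U (resolvent z U h)"
proof (cases "cmod z < 1")
  case True
  then show ?thesis by (rule resolvent_eq[OF unitary_contraction[OF U]])
next
  case False
  then have "cmod z > 1" using z by simp
  then have z': "cmod (1 / z) < 1" "z \<noteq> 0" by (auto simp: norm_divide divide_less_eq_1)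
  note c = unitary_contraction[OF U]
  have iU: "isometric_operator UNIV U" and surj: "surj U" using U by (auto simp: unitary_operator_def)
  have Ui: "U (inv U x) = x" for x by (rule surj_f_inv_f[OF surj])
  have inv: "inv U (U x) = x" for x by (rule inv_f_f[OF isometry_inj[OF iU]])
  have ci: "contraction (inv U)"
  proof (rule contractionI)
    show "inv U (x + y) = inv U x + inv U y" for x y
      using inv[of "inv U x + inv U y"] by (simp add: contraction_add[OF c] Ui)
    show "inv U (a *\<^sub>C x) = a *\<^sub>C inv U x" for a x
      using inv[of "a *\<^sub>C inv U x"] by (simp add: contraction_scaleC[OF c] Ui)
    show "norm (inv U x) \<le> norm x" for x
      using isometric_operator_norm[OF iU, of "inv U x"] by (simp add: Ui)
  qed
  have "\<exists>a. resolvent_pencil z U a = h" for h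
  proof -
    define a where "a = resolvent (1 / z) (inv U) ((- 1 / z) *\<^sub>C inv U h)"
    have "a = (- 1 / z) *\<^sub>C inv U h + (1 / z) *\<^sub>C inv U a"
      unfolding a_def by (rule resolvent_eq[OF ci z'(1)])
    then have "U a = (- 1 / z) *\<^sub>C h + (1 / z) *\<^sub>C a"
      using contraction_linear[OF c] Ui by metis
    then have "z *\<^sub>C U a = a - h"
      using z'(2) by (simp add: scaleC_linear scaleC_one)
    then show ?thesis by (intro exI[of _ a]) (simp add: resolvent_pencil_def)
  qed
  \<comment> \<open>Surjectivity of the pencil is enough here: \<open>inv\<close> is then a right
    inverse.\<close>
  then have "resolvent_pencil z U (resolvent z U h) = h"
    unfolding resolvent_def by (metis surj_def surj_f_inv_f)
  then show ?thesis by (simp add: resolvent_pencil_def algebra_simps)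
qed

text \<open>The weak form of \<open>R_z^* = E - R_(1 / cnj z)\<close>. Both resolvents lift to
  vectors \<open>a\<close>, \<open>b\<close> of the larger space, where \<open>U\<close> preserves
  inner products.\<close>

lemma generalized_resolvent_reflection:
  assumes R: "generalized_resolvent_for J U D V R" and z: "cmod z \<noteq> 1" "z \<noteq> 0"
  shows "cinner (R z x) y = cinner x y - cinner x (R (1 / cnj z) y)"
proof -
  have J: "isometric_operator UNIV J" and U: "unitary_operator U"
    and Req: "\<And>\<zeta> x. cmod \<zeta> \<noteq> 1 \<Longrightarrow> R \<zeta> x = isometry_adjoint J (resolvent \<zeta> U (J x))"
    using R by (auto simp: generalized_resolvent_for_iff)
  have iU: "isometric_operator UNIV U" using U by (simp add: unitary_operator_def)
  let ?w = "1 / cnj z"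
  have w: "cmod ?w \<noteq> 1" using z by (simp add: norm_divide)
  have zw: "z * cnj ?w = 1" using z by simp
  define a where "a = resolvent z U (J x)"
  define b where "b = resolvent ?w U (J y)"
  have a: "J x = a - z *\<^sub>C U a" using unitary_resolvent_eq[OF U z(1), of "J x"] by (simp add: a_def algebra_simps)
  have b: "J y = b - ?w *\<^sub>C U b" using unitary_resolvent_eq[OF U w, of "J y"] by (simp add: b_def algebra_simps)
  have 1: "cinner (R z x) y = cinner a (J y)" by (simp add: Req z a_def cinner_isometry_adjoint[OF J])
  have "cinner x (R ?w y) = cnj (cinner (R ?w y) x)" by (rule cinner_commute)
  also have "\<dots> = cnj (cinner b (J x))" by (simp add: Req[OF w] b_def cinner_isometry_adjoint[OF J])
  also have "\<dots> = cinner (J x) b" by (rule cinner_commute[symmetric])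
  finally have 2: "cinner x (R ?w y) = cinner (J x) b" .
  have "cinner (U a) (U b) = cinner a b" by (rule isometry_cinner[OF iU])
  \<comment> \<open>As \<open>z * cnj ?w = 1\<close>, the inner product of \<open>a\<close> and
    \<open>b\<close> occurs twice, once for each of the two mixed products into which the right side
    splits.\<close>
  then have "cinner (a - z *\<^sub>C U a) (b - ?w *\<^sub>C U b) = (1 + z * cnj ?w) * cinner a b
      - cnj ?w * cinner a (U b) - z * cinner (U a) b"
    by (simp only: cinner_linear) (simp add: algebra_simps)
  also have "\<dots> = cinner a (b - ?w *\<^sub>C U b) + cinner (a - z *\<^sub>C U a) b"
    unfolding zw by (simp only: cinner_linear) (simp add: algebra_simps)
  finally have "cinner (J x) (J y) = cinner a (J y) + cinner (J x) b"
    unfolding a[symmetric] b[symmetric] .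
  then show ?thesis by (simp add: 1 2 isometry_cinner[OF J])
qed

lemma generalized_resolvent_determined:
  assumes R: "generalized_resolvent_for J U D V R" and R': "generalized_resolvent_for J' U' D' V' R'"
    and eq: "\<And>z. cmod z < 1 \<Longrightarrow> R z = R' z" and z: "cmod z \<noteq> 1"
  shows "R z = R' z"
proof (cases "cmod z < 1")
  case False
  then have "cmod z > 1" using z by simp
  then have z0: "z \<noteq> 0" and w: "cmod (1 / cnj z) < 1" by (auto simp: norm_divide divide_less_eq_1)
  show ?thesis
    by (rule ext, rule cinner_ext)
       (simp only: generalized_resolvent_reflection[OF R z z0] generalized_resolvent_reflection[OF R' z z0] eq[OF w])
qed (rule eq)

section \<open>The parametrization\<close>

context analytic_contractions
begin

text \<open>The Neumann series of \<open>U\<close>, compressed to the \<open>q i\<close>, has the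
  same coefficients as the power series of \<open>R z\<close>; the coefficient of index 1 gives the
  compression of \<open>U\<close> itself.\<close>

lemma unitary_dilation:
  fixes q :: "nat \<Rightarrow> 'a"
  assumes q: "closure (range q) = UNIV"
  shows "\<exists>(J :: 'a \<Rightarrow> ell2) U. isometric_operator UNIV J \<and> unitary_operator U \<and>
    (\<forall>z x. cmod z < 1 \<longrightarrow> isometry_adjoint J (resolvent z U (J x)) = R z x) \<and>
    (\<forall>x. isometry_adjoint J (U (J x)) = T 0 x)"
proof -
  obtain J :: "'a \<Rightarrow> ell2" and U where J: "isometric_operator UNIV J" and U: "unitary_operator U"
    and UJ: "\<And>n i j. cinner ((U ^^ n) (J (q i))) (J (q j)) = toeplitz (int n) (q i) (q j)"
    using toeplitz_dilation[where \<kappa> = "\<lambda>n i j. toeplitz n (q i) (q j)", OF q toeplitz_positive]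
    by (auto simp: toeplitz_def coefficient_zero)
  note cU = unitary_contraction[OF U] and cJ = isometry_contraction[OF J]
    and cA = contraction_isometry_adjoint[OF J]
  have "isometry_adjoint J (resolvent z U (J x)) = R z x" if z: "cmod z < 1" for z x
  proof (rule eq_if_cinner_eq_dense[OF q, where A = "\<lambda>x. isometry_adjoint J (resolvent z U (J x))" and B = "R z"])
    show "bounded_linear (\<lambda>x. isometry_adjoint J (resolvent z U (J x)))"
      by (intro bounded_linear_compose[OF contraction_bounded_linear[OF cA]]
          bounded_linear_compose[OF bounded_linear_resolvent[OF cU z]] contraction_bounded_linear[OF cJ])
    show "bounded_linear (R z)" by (rule bounded_linear_resolvent[OF contraction[OF z] z])
    fix i j :: nat
    have "(\<lambda>n. cinner (z ^ n *\<^sub>C (U ^^ n) (J (q i))) (J (q j))) sums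
        cinner (resolvent z U (J (q i))) (J (q j))"
      by (rule bounded_linear.sums[OF bounded_bilinear.bounded_linear_left[OF bounded_bilinear_cinner]
            neumann_sums[OF cU z]])
    then have "(\<lambda>n. z ^ n * coefficient n (q i) (q j)) sums cinner (resolvent z U (J (q i))) (J (q j))"
      by (simp add: cinner_scaleC_left UJ toeplitz_def)
    from sums_unique2[OF this resolvent_sums[OF z]]
    show "cinner (isometry_adjoint J (resolvent z U (J (q i)))) (q j) = cinner (R z (q i)) (q j)"
      by (simp add: cinner_isometry_adjoint[OF J])
  qed
  moreover have "isometry_adjoint J (U (J x)) = T 0 x" for x
  proof (rule eq_if_cinner_eq_dense[OF q, where A = "\<lambda>x. isometry_adjoint J (U (J x))" and B = "T 0"])
    show "bounded_linear (\<lambda>x. isometry_adjoint J (U (J x)))"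
      by (rule contraction_bounded_linear[OF contraction_comp[OF cA contraction_comp[OF cU cJ]]])
    show "bounded_linear (T 0)" by (intro contraction_bounded_linear contraction) simp
    fix i j :: nat
    show "cinner (isometry_adjoint J (U (J (q i)))) (q j) = cinner (T 0 (q i)) (q j)"
      using UJ[of 1 i j] coefficient_one[of "q i" "q j"]
      by (simp add: cinner_isometry_adjoint[OF J] toeplitz_def)
  qed
  ultimately show ?thesis using J U by (intro exI[of _ J] exI[of _ U]) simp
qed

end

lemma schur_classD:
  assumes "F \<in> schur_class (ball 0 1) N N'" "cmod z < 1"
  shows "linear_operator N (F z)" "F z ` N \<subseteq> N'" "x \<in> N \<Longrightarrow> norm (F z x) \<le> norm x"
  using assms by (auto simp: schur_class_def)

text \<open>For contractions the bijectivity in \<open>resolvent_formula\<close> is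
  automatic.\<close>

lemma resolvent_formula_iff:
  assumes "\<And>z. cmod z < 1 \<Longrightarrow> contraction (direct_sum_operator D V (F z))"
  shows "resolvent_formula D V F R \<longleftrightarrow>
    (\<forall>z. cmod z < 1 \<longrightarrow> R z = resolvent z (direct_sum_operator D V (F z)))"
  using bij_resolvent_pencil[OF assms] by (auto simp: resolvent_formula_def resolvent_def)

text \<open>The larger space is a type argument: arbitrary in the direct part, \<open>ell2\<close>
  for existence in the converse. The uniqueness and injectivity clauses compare resolvents that may
  come from different larger spaces.\<close>

theorem theorem2p4:
  fixes D :: "'a::separable_complex_hilbert_space set" and V :: "'a \<Rightarrow> 'a"
  assumes "closed_operator D V" and "isometric_operator D V"
  shows "(\<forall>R. generalized_resolvent TYPE('b::separable_complex_hilbert_space) D V R \<longrightarrow>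
            (\<exists>F \<in> schur_class (ball 0 1) (defect_zero D) (defect_infinity D V).
               resolvent_formula D V F R)) \<and>
         (\<forall>F \<in> schur_class (ball 0 1) (defect_zero D) (defect_infinity D V).
            \<exists>R. generalized_resolvent TYPE(ell2) D V R \<and> resolvent_formula D V F R \<and>
              (\<forall>R'. generalized_resolvent TYPE('b) D V R' \<and> resolvent_formula D V F R' \<longrightarrow>
                 (\<forall>\<zeta>. cmod \<zeta> \<noteq> 1 \<longrightarrow> R' \<zeta> = R \<zeta>))) \<and>
         (\<forall>F1 \<in> schur_class (ball 0 1) (defect_zero D) (defect_infinity D V).
          \<forall>F2 \<in> schur_class (ball 0 1) (defect_zero D) (defect_infinity D V). \<forall>R1 R2.
            generalized_resolvent TYPE('b) D V R1 \<and> resolvent_formula D V F1 R1 \<and>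
            generalized_resolvent TYPE('c::separable_complex_hilbert_space) D V R2 \<and>
            resolvent_formula D V F2 R2 \<and>
            (\<exists>\<zeta> \<in> ball 0 1. \<exists>x \<in> defect_zero D. F1 \<zeta> x \<noteq> F2 \<zeta> x) \<longrightarrow>
            (\<exists>\<zeta>. cmod \<zeta> \<noteq> 1 \<and> R1 \<zeta> \<noteq> R2 \<zeta>))"
    (is "?direct \<and> ?converse \<and> ?injective")
proof (intro conjI)
  let ?S = "schur_class (ball 0 1) (defect_zero D) (defect_infinity D V)"
  have V: "linear_operator D V" using assms by (simp add: isometric_operator_def)
  then have D: "complex_vector.subspace D" by (simp add: linear_operator_def)
  have cD: "closed D" by (rule closed_isometric_domain[OF assms])
  have V0: "V 0 = 0" by (rule linear_operator_zero[OF V])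
  note Vnorm = isometric_operator_norm[OF assms(2)]
  have contr: "contraction (direct_sum_operator D V (F z))" if "F \<in> ?S" "cmod z < 1" for F z
    using schur_classD[OF that] by (intro direct_sum_contraction D cD assms(2)) auto
  have formula: "resolvent_formula D V F R \<longleftrightarrow>
      (\<forall>z. cmod z < 1 \<longrightarrow> R z = resolvent z (direct_sum_operator D V (F z)))" if "F \<in> ?S" for F R
    by (rule resolvent_formula_iff) (rule contr[OF that])
  show ?direct
  proof (intro allI impI)
    fix R assume "generalized_resolvent TYPE('b) D V R"
    then obtain J :: "'a \<Rightarrow> 'b" and U where "generalized_resolvent_for J U D V R"
      by (auto simp: generalized_resolvent_def)
    then have J: "isometric_operator UNIV J" and U: "unitary_operator U"
      and UV: "\<And>x. x \<in> D \<Longrightarrow> U (J x) = J (V x)"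
      and R: "\<And>\<zeta> x. cmod \<zeta> \<noteq> 1 \<Longrightarrow> R \<zeta> x = isometry_adjoint J (resolvent \<zeta> U (J x))"
      by (auto simp: generalized_resolvent_for_iff)
    \<comment> \<open>The whole characteristic function serves as parameter: its restriction to
      \<open>defect_zero D\<close> is the Schur function, and on \<open>D\<close> it agrees with
      \<open>V\<close>, so the direct sum reproduces it.\<close>
    let ?F = "characteristic_function J U"
    have cF: "contraction (?F z)" if "cmod z < 1" for z
      by (rule contraction_characteristic_function[OF J U that])
    have im: "?F z ` defect_zero D \<subseteq> defect_infinity D V" if "cmod z < 1" for z
      using cinner_characteristic_function[OF J U that UV]
      by (auto simp: defect_infinity_def defect_zero_def orthogonal_complement_def)
    have "operator_analytic_on ?F (ball 0 1) (defect_zero D) (defect_infinity D V)"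
      by (intro characteristic_function_analytic J U im)
         (simp_all add: defect_zero_def defect_infinity_def subspace_orthogonal_complement closed_orthogonal_complement)
    moreover have "linear_operator (defect_zero D) (?F z)" if "cmod z < 1" for z
      using cF[OF that] subspace_orthogonal_complement[of D]
      by (simp add: contraction_def linear_operator_def defect_zero_def)
    ultimately have FS: "?F \<in> ?S" using im contraction_norm[OF cF] by (simp add: schur_class_def)
    have sum: "direct_sum_operator D V (?F z) = ?F z" if z: "cmod z < 1" for z
    proof
      fix x
      have "?F z (orthogonal_projection D x) = V (orthogonal_projection D x)"
        by (intro characteristic_function_domain[OF J U z] UV orthogonal_projection_in[OF D cD])
      then show "direct_sum_operator D V (?F z) x = ?F z x"
        by (simp add: direct_sum_operator_def orthogonal_projection_complement[OF D cD] contraction_diff[OF cF[OF z]])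
    qed
    have "resolvent_formula D V ?F R"
      unfolding formula[OF FS]
      by (intro allI impI ext) (simp add: sum R compressed_resolvent[OF J U])
    with FS show "\<exists>F\<in>?S. resolvent_formula D V F R" by blast
  qed
  show ?converse
  proof
    fix F assume F: "F \<in> ?S"
    define T where "T z = direct_sum_operator D V (F z)" for z
    have cT: "contraction (T z)" if "cmod z < 1" for z unfolding T_def by (rule contr[OF F that])
    interpret analytic_contractions T
    proof
      fix z :: complex and x :: 'a assume z: "cmod z < 1"
      show "contraction (T z)" by (rule cT[OF z])
      let ?y = "orthogonal_projection (orthogonal_complement D) x"
      have "?y \<in> defect_zero D" unfolding defect_zero_def
        by (intro orthogonal_projection_in subspace_orthogonal_complement closed_orthogonal_complement)
      moreover have "\<exists>G. \<forall>x\<in>defect_zero D. ((\<lambda>w. inverse (w - z) *\<^sub>C (F w x - F z x)) \<longlongrightarrow> G x) (at z)"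
        using F z by (intro operator_analytic_tendsto) (auto simp: schur_class_def)
      \<comment> \<open>The \<open>V\<close> component does not depend on the point and
        cancels.\<close>
      moreover have "T w x - T z x = F w ?y - F z ?y" for w by (simp add: T_def direct_sum_operator_def)
      ultimately show "\<exists>g. ((\<lambda>w. inverse (w - z) *\<^sub>C (T w x - T z x)) \<longlongrightarrow> g) (at z)" by auto
    qed
    obtain q :: "nat \<Rightarrow> 'a" where q: "closure (range q) = UNIV" using dense_sequence_exists by blast
    obtain J :: "'a \<Rightarrow> ell2" and U where J: "isometric_operator UNIV J" and U: "unitary_operator U"
      and JR: "\<And>z x. cmod z < 1 \<Longrightarrow> isometry_adjoint J (resolvent z U (J x)) = R z x"
      and JT: "\<And>x. isometry_adjoint J (U (J x)) = T 0 x"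
      using unitary_dilation[OF q] by blast
    have UV: "U (J x) = J (V x)" if x: "x \<in> D" for x
    proof -
      have iU: "isometric_operator UNIV U" using U by (simp add: unitary_operator_def)
      have "F 0 0 = 0" using schur_classD(1)[OF F, of 0] by (intro linear_operator_zero) auto
      then have "T 0 x = V x" unfolding T_def by (rule direct_sum_operator_domain[OF D cD _ x])
      \<comment> \<open>The equality case of Cauchy-Schwarz: both vectors have the norm of
        \<open>x\<close>, and their inner product is its square.\<close>
      then have "cinner (U (J x)) (J (V x)) = cinner (V x) (V x)"
        by (simp add: JT flip: cinner_isometry_adjoint[OF J])
      then have "(norm (U (J x) - J (V x)))\<^sup>2 = 0"
        using Vnorm[OF x]
        by (simp add: norm_diff_sq isometric_operator_norm[OF J] isometric_operator_norm[OF iU] flip: norm_sq_cinner)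
      then show ?thesis by simp
    qed
    define R0 where "R0 z x = isometry_adjoint J (resolvent z U (J x))" for z x
    have G: "generalized_resolvent_for J U D V R0"
      using J U UV by (simp add: generalized_resolvent_for_iff R0_def)
    have "resolvent_formula D V F R0"
      unfolding formula[OF F] using JR by (auto simp: R0_def T_def fun_eq_iff)
    moreover have "R' \<zeta> = R0 \<zeta>" if "generalized_resolvent TYPE('b) D V R'" "resolvent_formula D V F R'"
      "cmod \<zeta> \<noteq> 1" for R' \<zeta>
    proof -
      obtain J' :: "'a \<Rightarrow> 'b" and U' where G': "generalized_resolvent_for J' U' D V R'"
        using \<open>generalized_resolvent TYPE('b) D V R'\<close> by (auto simp: generalized_resolvent_def)
      show ?thesis
        by (rule generalized_resolvent_determined[OF G' G _ \<open>cmod \<zeta> \<noteq> 1\<close>])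
           (use that(2) \<open>resolvent_formula D V F R0\<close> in \<open>simp add: formula[OF F]\<close>)
    qed
    ultimately show "\<exists>R. generalized_resolvent TYPE(ell2) D V R \<and> resolvent_formula D V F R \<and>
        (\<forall>R'. generalized_resolvent TYPE('b) D V R' \<and> resolvent_formula D V F R' \<longrightarrow>
          (\<forall>\<zeta>. cmod \<zeta> \<noteq> 1 \<longrightarrow> R' \<zeta> = R \<zeta>))"
      using G by (intro exI[of _ R0]) (auto simp: generalized_resolvent_def)
  qed
  have inj: "F1 z x = F2 z x"
    if F: "F1 \<in> ?S" "F2 \<in> ?S" and f: "resolvent_formula D V F1 R1" "resolvent_formula D V F2 R2"
      and eq: "\<And>\<zeta>. cmod \<zeta> \<noteq> 1 \<Longrightarrow> R1 \<zeta> = R2 \<zeta>" and z: "cmod z < 1" and x: "x \<in> defect_zero D"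
    for F1 F2 R1 R2 z x
  proof -
    have punctured: "F1 w x = F2 w x" if w: "cmod w < 1" "w \<noteq> 0" for w
    proof -
      have "resolvent w (direct_sum_operator D V (F1 w)) = resolvent w (direct_sum_operator D V (F2 w))"
        using f eq[of w] w by (simp add: formula[OF F(1)] formula[OF F(2)])
      then have "direct_sum_operator D V (F1 w) x = direct_sum_operator D V (F2 w) x"
        by (intro resolvent_inject[OF contr[OF F(1) w(1)] contr[OF F(2) w(1)] w]) simp
      then show ?thesis by (simp add: direct_sum_operator_defect[where V = V, OF D cD V0 x])
    qed
    have lim: "((\<lambda>w. F w x) \<longlongrightarrow> F 0 x) (at 0)" if "F \<in> ?S" for F
    proof -
      have "\<exists>G. \<forall>x\<in>defect_zero D. ((\<lambda>w. inverse (w - 0) *\<^sub>C (F w x - F 0 x)) \<longlongrightarrow> G x) (at 0)"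
        using that by (intro operator_analytic_tendsto) (auto simp: schur_class_def)
      then obtain g where "((\<lambda>w. inverse (w - 0) *\<^sub>C (F w x - F 0 x)) \<longlongrightarrow> g) (at 0)"
        using x by blast
      then show ?thesis by (rule tendsto_from_difference_quotient)
    qed
    show ?thesis
    proof (cases "z = 0")
      case True
      have "\<forall>\<^sub>F w in at 0. w \<in> ball 0 1 - {0 :: complex}" by (rule eventually_at_in_open) auto
      then have "\<forall>\<^sub>F w in at 0. F1 w x = F2 w x" by (rule eventually_mono) (auto intro: punctured)
      with lim[OF F(1)] have "((\<lambda>w. F2 w x) \<longlongrightarrow> F1 0 x) (at 0)" by (rule Lim_transform_eventually)
      with lim[OF F(2)] show ?thesis unfolding True by (metis tendsto_unique trivial_limit_at)
    qed (use punctured z in auto)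
  qed
  show ?injective
  proof (intro ballI allI impI, elim conjE bexE)
    fix F1 F2 R1 R2 \<zeta> x
    assume h: "F1 \<in> ?S" "F2 \<in> ?S" "resolvent_formula D V F1 R1" "resolvent_formula D V F2 R2"
      "\<zeta> \<in> ball 0 1" "x \<in> defect_zero D" "F1 \<zeta> x \<noteq> F2 \<zeta> x"
    show "\<exists>\<zeta>. cmod \<zeta> \<noteq> 1 \<and> R1 \<zeta> \<noteq> R2 \<zeta>"
    proof (rule ccontr)
      assume "\<not> ?thesis"
      then have "R1 \<zeta> = R2 \<zeta>" if "cmod \<zeta> \<noteq> 1" for \<zeta> using that by blast
      from inj[OF h(1-4) this, of \<zeta> x] h(5-7) show False by simp
    qed
  qed
qed

end
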